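(* Let $S \subset \mathbb{R}$ be a finite set. For each $n \in \mathbb{N}$ let $P_{2n}(z) = \sum_{j=0}^{2n} a_{j,2n} z^j$ be a polynomial with all coefficients $a_{0,2n},\ldots,a_{2n,2n}$ in $S$ that is self-reciprocal, i.e. $a_{j,2n} = a_{2n-j,2n}$ for $j=0,1,\ldots,2n$. Put $$T_n(t) := P_{2n}(e^{it})e^{-int}.$$ If $$\lim_{n \to \infty} \mathrm{NC}_k(P_{2n}) = \infty \quad \text{for every } k \in \mathbb{N},$$ then $$\lim_{n \to \infty} \mathrm{NZ}(T_n) = \infty.$$
   Context: $\mathbb{N}=\{1,2,3,\ldots\}$. For a polynomial $P_N(z) = \sum_{j=0}^N a_{j,N} z^j$ and $k \in \mathbb{N}$, $$\mathrm{NC}_k(P_N) := \Big|\Big\{u \in \mathbb{Z}: 0 \leq u \leq N-k+1,\ \sum_{j=u}^{u+k-1} a_{j,N} \neq 0\Big\}\Big|,$$ where coefficients with index larger than $N$ are read as $0$. Since $P_{2n}$ is self-reciprocal with real coefficients, $T_n$ is a real even trigonometric polynomial of degree at most $n$. $\mathrm{NZ}(T_n)$ denotes the number of real zeros of $T_n$, counted with multiplicities, in a period $[a,a+2\pi)$, $a \in \mathbb{R}$ (with value $\infty$ if $T_n \equiv 0$). *)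

theory Defs
  imports "HOL-Complex_Analysis.Complex_Analysis" "HOL-Library.Extended_Real"
begin

text \<open>
  A polynomial \<open>P\<^sub>N\<close> is a \<open>real poly\<close> of degree at most \<open>N\<close>; the leading coefficient may vanish,
  so the nominal degree \<open>N\<close> is passed separately.  The condition \<open>u + k \<le> N + 1\<close> is
  \<open>u \<le> N - k + 1\<close> without truncated subtraction (for \<open>k > N + 1\<close> there is no such \<open>u\<close>).
\<close>

definition NC :: "nat \<Rightarrow> nat \<Rightarrow> real poly \<Rightarrow> nat" where
  "NC k N p = card {u::nat. u + k \<le> N + 1 \<and> (\<Sum>j=u..<u + k. coeff p j) \<noteq> 0}"

definition self_reciprocal :: "nat \<Rightarrow> real poly \<Rightarrow> bool" where
  "self_reciprocal N p \<longleftrightarrow> (\<forall>j\<le>N. coeff p j = coeff p (N - j))"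

text \<open>
  \<open>T\<^sub>n(t) = P\<^sub>2\<^sub>n(e\<^sup>i\<^sup>t) e\<^sup>-\<^sup>i\<^sup>n\<^sup>t\<close>, as an entire function of \<open>t\<close>, so that the multiplicity of a real zero
  is available as \<^const>\<open>zorder\<close>.
\<close>

definition T :: "nat \<Rightarrow> real poly \<Rightarrow> complex \<Rightarrow> complex" where
  "T n p t = poly (map_poly complex_of_real p) (exp (\<i> * t)) * exp (- (\<i> * of_nat n * t))"

text \<open>
  Zeros on the real line in \<open>[a, a + 2\<pi>)\<close>, with multiplicity.  Intended for trigonometric polynomials
  \<open>f\<close>: the zero set below is then finite unless \<open>f\<close> vanishes identically.
\<close>

definition NZ :: "real \<Rightarrow> (complex \<Rightarrow> complex) \<Rightarrow> enat" where
  "NZ a f =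
    (if \<forall>t::real. f (of_real t) = 0 then \<infinity>
     else enat (\<Sum>t | t \<in> {a..<a + 2 * pi} \<and> f (of_real t) = 0. nat (zorder f (of_real t))))"

end

theory Submission
  imports Defs "HOL-Library.Ramsey"
begin

text \<open>
  Suppose that \<open>T\<^sub>n\<close> has at most \<open>M\<close> zeros.  Multiplying it by factors \<open>2 (cos t - x)\<close> at its sign changes
  gives a trigonometric polynomial of constant sign, whose coefficient sequence \<open>c\<close> is therefore (up to
  sign) positive definite, is bounded in terms of \<open>M\<close> and takes boundedly many values.  A qualitative
  version of Helson's theorem shows that only boundedly many coefficients of \<open>c\<close> are not small: otherwise
  Ramsey's theorem produces long families of frequencies with constant correlations, these lead to an
  approximately idempotent multiplier, and the latter to a period of \<open>c\<close>, which is impossible for a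
  finitely supported sequence.  Where \<open>c\<close> is small, the coefficients of \<open>T\<^sub>n\<close> obey a linear recurrence up to
  an error below the separation of \<open>S\<close>, hence are periodic with a period \<open>K\<close> depending on \<open>S\<close> and \<open>M\<close> only.
  So \<open>sin (K t / 2) T\<^sub>n(t)\<close> has boundedly many frequencies.  Grouping them into clumps at a suitable scale, and
  integrating over a zero-free interval near \<open>0\<close>, one finds that the coefficients in every clump away from
  frequency \<open>0\<close> sum to zero, which makes all but boundedly many sums over windows of length \<open>K\<close> vanish.
\<close>

section \<open>Positive definite sequences with separated values\<close>

text \<open>A positive definite \<open>c\<close> is handled as a Gram function: picture vectors
  \<open>v z\<close> with inner products \<open>c (z - z')\<close>. No Hilbert space is built; each
  geometric fact is a test of the definition with explicit weights. The obstacle is uniformity. The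
  degree is unbounded while only \<open>S\<close> and the zero bound \<open>M\<close> are fixed, so
  every constant, in particular the window length \<open>K\<close>, has to be chosen before the
  sequence. Hence the contraposition, the finite form of Ramsey's theorem, and a \<open>K\<close>
  that depends on \<open>M\<close>. The Ramsey step terminates because passing to the differences
  \<open>x (2 * J) - x (2 * J + 1)\<close> lowers the common correlation by at least
  \<open>\<gamma>\<close> and yet keeps it at least \<open>\<gamma>\<close>; this can happen about
  \<open>C / \<gamma>\<close> times at most. Periodicity with few exceptions does not settle the
  claim, since the sum over a period may still be nonzero. The clump argument therefore uses the
  zero bound a second time. A clump at frequency 0 escapes its integral estimate, but the
  differences have total sum 0, which covers that clump too.\<close>

definition pos_def :: "(int \<Rightarrow> real) \<Rightarrow> bool" where
  "pos_def c \<longleftrightarrow> (\<forall>j. c (- j) = c j) \<and>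
    (\<forall>(n::nat) g x. 0 \<le> (\<Sum>i<n. \<Sum>j<n. g i * g j * c (x i - x j)))"

section \<open>Gram sums and the Cauchy-Schwarz inequality\<close>

lemma pos_def_minus: "pos_def c \<Longrightarrow> c (- j) = c j"
  by (simp add: pos_def_def)

lemma pos_def_commute: "pos_def c \<Longrightarrow> c (i - j) = c (j - i)"
  using pos_def_minus[of c "j - i"] by simp

text \<open>The definition speaks of initial segments of the naturals; option types and sum types
  serve as index types below, to adjoin one vector or to merge two families.\<close>

lemma pos_def_sum:
  assumes "pos_def c" "finite I"
  shows "0 \<le> (\<Sum>i\<in>I. \<Sum>j\<in>I. g i * g j * c (x i - x j))"
proof -
  obtain h where h: "bij_betw h {..<card I} I"
    using ex_bij_betw_nat_finite[OF assms(2)] lessThan_atLeast0 by auto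
  have "(\<Sum>i\<in>I. \<Sum>j\<in>I. g i * g j * c (x i - x j))
      = (\<Sum>i<card I. \<Sum>j\<in>I. g (h i) * g j * c (x (h i) - x j))"
    by (rule sum.reindex_bij_betw[OF h, symmetric])
  also have "\<dots> = (\<Sum>i<card I. \<Sum>j<card I. g (h i) * g (h j) * c (x (h i) - x (h j)))"
    by (intro sum.cong refl sum.reindex_bij_betw[OF h, symmetric])
  also have "\<dots> \<ge> 0"
    using assms(1) unfolding pos_def_def by (elim conjE allE[of _ "card I"] allE[of _ "g \<circ> h"] allE[of _ "x \<circ> h"]) simp
  finally show ?thesis .
qed

text \<open>The vector \<open>v z\<close> is tested against the combination of the
  \<open>v (x i)\<close> with weights \<open>g i\<close>, whose squared norm is the double sum. An
  upper bound \<open>C\<close> stands in for \<open>c 0\<close>, so that one constant serves all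
  sequences.\<close>

lemma pos_def_Cauchy_Schwarz:
  assumes c: "pos_def c" and I: "finite I" and C: "c 0 \<le> C" "0 < C"
  shows "(\<Sum>i\<in>I. g i * c (x i - z))\<^sup>2 \<le> C * (\<Sum>i\<in>I. \<Sum>j\<in>I. g i * g j * c (x i - x j))"
proof -
  define b where "b = (\<Sum>i\<in>I. g i * c (x i - z))"
  define Q where "Q = (\<Sum>i\<in>I. \<Sum>j\<in>I. g i * g j * c (x i - x j))"
  \<comment> \<open>The minimiser of \<open>l\<^sup>2 * C + 2 * l * b + Q\<close>. The index
    \<open>None\<close> carries the adjoined point \<open>z\<close>.\<close>
  define l where "l = - (b / C)"
  define g' where "g' = (\<lambda>k. case k of None \<Rightarrow> l | Some i \<Rightarrow> g i)"
  define x' where "x' = (\<lambda>k. case k of None \<Rightarrow> z | Some i \<Rightarrow> x i)"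
  have ins: "sum f (insert None (Some ` I)) = f None + (\<Sum>i\<in>I. f (Some i))" for f :: "'a option \<Rightarrow> real"
    using I by (subst sum.insert) (auto simp: sum.reindex)
  have "0 \<le> (\<Sum>i\<in>insert None (Some ` I). \<Sum>j\<in>insert None (Some ` I). g' i * g' j * c (x' i - x' j))"
    by (rule pos_def_sum[OF c]) (use I in auto)
  also have "\<dots> = l * l * c 0 + (\<Sum>i\<in>I. l * (g i * c (z - x i))) + ((\<Sum>i\<in>I. l * (g i * c (x i - z))) + Q)"
    by (simp add: ins g'_def x'_def Q_def sum.distrib algebra_simps)
  also have "(\<Sum>i\<in>I. l * (g i * c (z - x i))) = l * b"
    unfolding b_def sum_distrib_left using pos_def_commute[OF c] by metis
  also have "(\<Sum>i\<in>I. l * (g i * c (x i - z))) = l * b"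
    unfolding b_def sum_distrib_left ..
  finally have "0 \<le> l * l * c 0 + 2 * l * b + Q" by (simp add: algebra_simps)
  also have "\<dots> \<le> l * l * C + 2 * l * b + Q"
    using C by (simp add: mult_left_mono)
  also have "l * l * C + 2 * l * b + Q = Q - b\<^sup>2 / C"
    using C by (simp add: l_def field_simps power2_eq_square)
  finally show ?thesis
    unfolding b_def[symmetric] Q_def[symmetric] using C by (simp add: field_simps)
qed

lemma pos_def_bound:
  assumes c: "pos_def c" and C: "c 0 \<le> C" "0 < C"
  shows "\<bar>c z\<bar> \<le> C"
proof -
  have "(c z)\<^sup>2 \<le> C * c 0"
    using pos_def_Cauchy_Schwarz[OF c _ C, of "{()}" "\<lambda>_. 1" "\<lambda>_. z" 0] by simp
  also have "\<dots> \<le> C\<^sup>2"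
    using C by (simp add: power2_eq_square)
  finally show ?thesis
    using C by (simp add: abs_le_square_iff[symmetric])
qed

text \<open>Each column meets the diagonal at most once, and that entry falls short of
  \<open>m\<close> by at most \<open>2 * C\<close>; spread over \<open>card E\<close> rows this
  costs \<open>2 * C / card E\<close>. The sets \<open>E\<close> and \<open>G\<close> may overlap in
  any way.\<close>

lemma sum_off_diagonal_ge:
  fixes h :: "'a \<Rightarrow> 'a \<Rightarrow> real"
  assumes "finite E" "finite G" "E \<noteq> {}"
    and off: "\<And>i j. i \<in> E \<Longrightarrow> j \<in> G \<Longrightarrow> i \<noteq> j \<Longrightarrow> m \<le> h i j"
    and diag: "\<And>i. i \<in> E \<Longrightarrow> i \<in> G \<Longrightarrow> - C \<le> h i i" and "m \<le> C" "0 \<le> C"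
  shows "real (card E) * real (card G) * (m - 2 * C / card E) \<le> (\<Sum>i\<in>E. \<Sum>j\<in>G. h i j)"
proof -
  have "real (card E) * real (card G) * (m - 2 * C / card E)
      = (\<Sum>j\<in>G. real (card E) * m - 2 * C)"
    using assms by (simp add: field_simps card_gt_0_iff)
  also have "\<dots> \<le> (\<Sum>j\<in>G. \<Sum>i\<in>E. h i j)"
  proof (rule sum_mono)
    fix j assume j: "j \<in> G"
    have "real (card E) * m - 2 * C \<le> (\<Sum>i\<in>E. m - (if i = j then 2 * C else 0))"
      using assms by (simp add: sum_subtractf)
    also have "\<dots> \<le> (\<Sum>i\<in>E. h i j)"
      by (rule sum_mono) (use off diag j \<open>m \<le> C\<close> in fastforce)
    finally show "real (card E) * m - 2 * C \<le> (\<Sum>i\<in>E. h i j)" .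
  qed
  also have "\<dots> = (\<Sum>i\<in>E. \<Sum>j\<in>G. h i j)"
    by (rule sum.swap)
  finally show ?thesis .
qed

lemma sum_off_diagonal_le:
  fixes h :: "'a \<Rightarrow> 'a \<Rightarrow> real"
  assumes "finite E" "finite G" "E \<noteq> {}"
    and "\<And>i j. i \<in> E \<Longrightarrow> j \<in> G \<Longrightarrow> i \<noteq> j \<Longrightarrow> h i j \<le> m"
    and "\<And>i. i \<in> E \<Longrightarrow> i \<in> G \<Longrightarrow> h i i \<le> C" and "- C \<le> m" "0 \<le> C"
  shows "(\<Sum>i\<in>E. \<Sum>j\<in>G. h i j) \<le> real (card E) * real (card G) * (m + 2 * C / card E)"
  using sum_off_diagonal_ge[of E G "- m" "\<lambda>i j. - h i j" C] assms
  by (simp add: sum_negf algebra_simps)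

text \<open>In a Hilbert space with vectors \<open>v z\<close> whose inner products are \<open>c (z - z')\<close>, this is Cauchy-Schwarz
  for \<open>v z\<close> and the difference of the means of \<open>v (x i)\<close> over \<open>E\<close> and \<open>v (y j)\<close> over \<open>G\<close>.\<close>

lemma pos_def_two_means:
  assumes c: "pos_def c" and C: "c 0 \<le> C" "0 < C"
    and E: "finite E" "E \<noteq> {}" and G: "finite G" "G \<noteq> {}"
    and EE: "(\<Sum>i\<in>E. \<Sum>j\<in>E. c (x i - x j)) \<le> real (card E) * real (card E) * a"
    and GG: "(\<Sum>i\<in>G. \<Sum>j\<in>G. c (y i - y j)) \<le> real (card G) * real (card G) * b"
    and EG: "real (card E) * real (card G) * m \<le> (\<Sum>i\<in>E. \<Sum>j\<in>G. c (x i - y j))"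
  shows "((\<Sum>i\<in>E. c (x i - z)) / card E - (\<Sum>j\<in>G. c (y j - z)) / card G)\<^sup>2 \<le> C * (a + b - 2 * m)"
proof -
  define e where "e = real (card E)"
  define f where "f = real (card G)"
  have pos: "e > 0" "f > 0"
    using E G by (simp_all add: e_def f_def card_gt_0_iff)
  define I where "I = E <+> G"
  \<comment> \<open>Weights of the difference of the two means, on a disjoint sum so that shared
    indices do no harm.\<close>
  define w where "w = (\<lambda>k::'a + 'b. case k of Inl _ \<Rightarrow> 1 / e | Inr _ \<Rightarrow> - 1 / f)"
  define p where "p = (\<lambda>k. case k of Inl i \<Rightarrow> x i | Inr j \<Rightarrow> y j)"
  have split: "sum F I = (\<Sum>i\<in>E. F (Inl i)) + (\<Sum>j\<in>G. F (Inr j))" for F :: "'a + 'b \<Rightarrow> real"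
    unfolding I_def using E G by (simp add: sum.Plus)
  have "(\<Sum>k\<in>I. w k * c (p k - z)) = (\<Sum>i\<in>E. c (x i - z)) / e - (\<Sum>j\<in>G. c (y j - z)) / f"
    by (simp add: split w_def p_def sum_divide_distrib sum_negf)
  moreover have "(\<Sum>k\<in>I. \<Sum>l\<in>I. w k * w l * c (p k - p l)) \<le> a + b - 2 * m"
  proof -
    have GE: "(\<Sum>j\<in>G. \<Sum>i\<in>E. c (y j - x i)) = (\<Sum>i\<in>E. \<Sum>j\<in>G. c (x i - y j))"
      by (subst sum.swap) (simp add: pos_def_commute[OF c])
    have "(\<Sum>k\<in>I. \<Sum>l\<in>I. w k * w l * c (p k - p l))
      = (\<Sum>i\<in>E. \<Sum>j\<in>E. c (x i - x j)) / (e * e) + (\<Sum>i\<in>G. \<Sum>j\<in>G. c (y i - y j)) / (f * f)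
        - (\<Sum>i\<in>E. \<Sum>j\<in>G. c (x i - y j)) / (e * f) - (\<Sum>j\<in>G. \<Sum>i\<in>E. c (y j - x i)) / (e * f)"
      by (simp add: split w_def p_def sum_divide_distrib sum_negf sum.distrib sum_subtractf mult.commute)
    also have "(\<Sum>i\<in>E. \<Sum>j\<in>E. c (x i - x j)) / (e * e) \<le> a"
      using EE pos by (simp add: e_def field_simps)
    also have "(\<Sum>i\<in>G. \<Sum>j\<in>G. c (y i - y j)) / (f * f) \<le> b"
      using GG pos by (simp add: f_def field_simps)
    finally have 1: "(\<Sum>k\<in>I. \<Sum>l\<in>I. w k * w l * c (p k - p l))
       \<le> a + b - 2 * ((\<Sum>i\<in>E. \<Sum>j\<in>G. c (x i - y j)) / (e * f))"
      by (simp add: GE)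
    have "m \<le> (\<Sum>i\<in>E. \<Sum>j\<in>G. c (x i - y j)) / (e * f)"
      using EG pos by (simp add: e_def f_def field_simps)
    with 1 show ?thesis by linarith
  qed
  ultimately show ?thesis
    using pos_def_Cauchy_Schwarz[OF c _ C, of I w p z] E G C
    unfolding e_def[symmetric] f_def[symmetric] I_def
    by (smt (verit) finite_Plus mult_left_mono)
qed

text \<open>\<open>\<eta>\<close> is such that an error \<open>C * \<eta>\<close> in a squared
  distance is far below \<open>\<gamma>\<^sup>2\<close>. Values known to differ by less than
  \<open>\<gamma>\<close> differ by at most \<open>\<eta>\<close>, so errors do not accumulate.
  Finite support makes 0 a value of \<open>c\<close>, hence the gap applies to
  \<open>\<bar>c i\<bar>\<close> as well.\<close>

locale gapped =
  fixes c :: "int \<Rightarrow> real" and C \<gamma> \<eta> :: real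
  assumes pd: "pos_def c" and fin: "finite {j. c j \<noteq> 0}" and c0: "c 0 \<le> C"
    and \<gamma>: "0 < \<gamma>" "\<gamma> \<le> C" and \<eta>: "64 * C * \<eta> = \<gamma>\<^sup>2"
    and gap: "\<bar>c i - c j\<bar> \<le> \<eta> \<or> \<gamma> \<le> \<bar>c i - c j\<bar>"
begin

lemma half_sq: "(\<gamma> / 2)\<^sup>2 = \<gamma>\<^sup>2 / 4" "0 < \<gamma>\<^sup>2"
  using \<gamma> by (simp_all add: power_divide)

lemma C_pos: "0 < C" using \<gamma> by simp

lemma eta_pos: "0 < \<eta>"
  using \<eta> \<gamma> C_pos by (metis zero_less_power zero_less_mult_pos mult_pos_pos zero_less_numeral)

lemma eta_le: "64 * \<eta> \<le> \<gamma>"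
proof -
  have "(64 * \<eta>) * C = \<gamma> * \<gamma>"
    using \<eta> by (simp add: power2_eq_square algebra_simps)
  also have "\<dots> \<le> \<gamma> * C"
    using \<gamma> by (simp add: mult_left_mono)
  finally show ?thesis using C_pos by simp
qed

lemma bound: "\<bar>c z\<bar> \<le> C"
  using pos_def_bound[OF pd c0 C_pos] .

lemma zero_value: "\<exists>j. c j = 0"
  using fin ex_new_if_finite[OF infinite_UNIV_int fin] by auto

lemma gap_zero: "\<bar>c i\<bar> \<le> \<eta> \<or> \<gamma> \<le> \<bar>c i\<bar>"
  using zero_value gap[of i] by (metis diff_zero)

lemma comm: "c (i - j) = c (j - i)" using pos_def_commute[OF pd] .

lemma near_close: "\<bar>c i - c j\<bar> < \<gamma> \<Longrightarrow> \<bar>c i - c j\<bar> \<le> \<eta>"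
  using gap[of i j] by linarith

text \<open>If shifting by \<open>d\<close> does not change the correlations of the unit vectors \<open>x i\<close>, then the value of
  \<open>c\<close> at \<open>x i - z\<close>, for most \<open>i\<close>, is unchanged by \<open>z \<mapsto> z + d\<close>, contradicting finite support.\<close>

lemma no_period:
  assumes L: "256 * C\<^sup>2 \<le> \<gamma>\<^sup>2 * real L" "2 \<le> L" and d: "d \<noteq> 0" and "\<gamma> \<le> c k0"
    and x: "\<And>i j. i < L \<Longrightarrow> j < L \<Longrightarrow> i \<noteq> j \<Longrightarrow> \<bar>c (x i - x j) - c k0\<bar> \<le> \<eta>"
    and xd: "\<And>i j. i < L \<Longrightarrow> j < L \<Longrightarrow> i \<noteq> j \<Longrightarrow> \<bar>c (x i - x j - d) - c k0\<bar> \<le> \<eta>"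
  shows False
proof -
  \<comment> \<open>The induction shows that at most half of the indices are bad for each
    \<open>k\<close>; finite support makes all of them bad for a suitable \<open>k\<close>.\<close>
  define Bad where "Bad = (\<lambda>k::nat. {i. i < L \<and> \<gamma> \<le> \<bar>c (x i - (x 0 + int k * d)) - c k0\<bar>})"
  have finB: "finite (Bad k)" for k by (simp add: Bad_def)
  have half: "2 * card (Bad k) \<le> L" for k
  proof (induction k)
    case 0
    have "Bad 0 \<subseteq> {0}"
      using x[of _ 0] L(2) eta_le \<gamma> by (auto simp: Bad_def) fastforce
    then have "card (Bad 0) \<le> 1"
      using card_mono[of "{0::nat}"] by fastforce
    then show ?case using L by simp
  next
    case (Suc k)
    show ?case
    proof (rule ccontr)
      assume big: "\<not> 2 * card (Bad (Suc k)) \<le> L"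
      define z where "z = x 0 + int k * d"
      define G where "G = {..<L} - Bad k"
      have "Bad k \<subseteq> {..<L}" by (auto simp: Bad_def)
      then have cG: "L \<le> 2 * card G"
        using Suc.IH by (simp add: G_def card_Diff_subset[OF finB])
      define Ep where "Ep = {i. i < L \<and> c k0 + \<gamma> \<le> c (x i - d - z)}"
      define Em where "Em = {i. i < L \<and> c (x i - d - z) \<le> c k0 - \<gamma>}"
      have "Bad (Suc k) = Ep \<union> Em"
        by (auto simp: Bad_def Ep_def Em_def z_def algebra_simps)
      then have "L \<le> 2 * (card Ep + card Em)"
        using big card_Un_le[of Ep Em] by simp
      \<comment> \<open>At least a quarter of the indices deviates in one direction, so averaging
        cannot cancel the deviation.\<close>
      then have "L \<le> 4 * card Ep \<or> L \<le> 4 * card Em" by arith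
      then obtain E where E: "E = Ep \<or> E = Em" "L \<le> 4 * card E" by blast
      have fE: "finite E" using E by (auto simp: Ep_def Em_def)
      have EL: "E \<subseteq> {..<L}" using E by (auto simp: Ep_def Em_def)
      have fG: "finite G" by (simp add: G_def)
      have GL: "G \<subseteq> {..<L}" by (auto simp: G_def)
      have ne: "E \<noteq> {}" "G \<noteq> {}" using E(2) cG L(2) by auto
      define e where "e = real (card E)"
      define f where "f = real (card G)"
      have e: "0 < e" "real L \<le> 4 * e" and f: "0 < f" "real L \<le> 2 * f"
        using ne fE fG E(2) cG by (auto simp: e_def f_def card_gt_0_iff)
      have k0: "c k0 \<le> C" using bound[of k0] by simp
      have meanE: "\<bar>(\<Sum>i\<in>E. c (x i - d - z)) / e - c k0\<bar> \<ge> \<gamma>"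
      proof -
        consider "E = Ep" | "E = Em" using E by blast
        then show ?thesis
        proof cases
          case 1
          have "(\<Sum>i\<in>E. c k0 + \<gamma>) \<le> (\<Sum>i\<in>E. c (x i - d - z))"
            by (rule sum_mono) (auto simp: 1 Ep_def)
          then have "c k0 + \<gamma> \<le> (\<Sum>i\<in>E. c (x i - d - z)) / e"
            using e by (simp add: e_def field_simps)
          then show ?thesis by simp
        next
          case 2
          have "(\<Sum>i\<in>E. c (x i - d - z)) \<le> (\<Sum>i\<in>E. c k0 - \<gamma>)"
            by (rule sum_mono) (auto simp: 2 Em_def)
          then have "(\<Sum>i\<in>E. c (x i - d - z)) / e \<le> c k0 - \<gamma>"
            using e by (simp add: e_def field_simps)
          then show ?thesis by simp
        qed
      qed
      have meanG: "\<bar>(\<Sum>i\<in>G. c (x i - z)) / f - c k0\<bar> \<le> \<eta>"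
      proof -
        have near: "\<bar>c (x i - z) - c k0\<bar> \<le> \<eta>" if "i \<in> G" for i
          using that near_close[of "x i - z" k0] by (auto simp: G_def Bad_def z_def)
        have "(\<Sum>i\<in>G. c (x i - z)) \<le> (\<Sum>i\<in>G. c k0 + \<eta>)"
          by (rule sum_mono) (use near in fastforce)
        moreover have "(\<Sum>i\<in>G. c k0 - \<eta>) \<le> (\<Sum>i\<in>G. c (x i - z))"
          by (rule sum_mono) (use near in fastforce)
        ultimately have "(\<Sum>i\<in>G. c (x i - z)) / f \<le> c k0 + \<eta>" "c k0 - \<eta> \<le> (\<Sum>i\<in>G. c (x i - z)) / f"
          using f by (simp_all add: f_def field_simps)
        then show ?thesis by simp
      qed
      \<comment> \<open>By \<open>x\<close> and \<open>xd\<close> all three averaged correlations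
        are close to \<open>c k0\<close>; the two means are then close as vectors and must have
        nearly the same correlation with \<open>z\<close>.\<close>
      have "((\<Sum>i\<in>E. c (x i - d - z)) / card E - (\<Sum>j\<in>G. c (x j - z)) / card G)\<^sup>2
          \<le> C * ((c k0 + \<eta> + 2 * C / e) + (c k0 + \<eta> + 2 * C / f) - 2 * (c k0 - \<eta> - 2 * C / e))"
      proof (rule pos_def_two_means[OF pd c0 C_pos fE ne(1) fG ne(2)])
        show "(\<Sum>i\<in>E. \<Sum>j\<in>E. c (x i - d - (x j - d))) \<le> real (card E) * real (card E) * (c k0 + \<eta> + 2 * C / e)"
          unfolding e_def
        proof (rule sum_off_diagonal_le[OF fE fE ne(1)])
          fix i j assume "i \<in> E" "j \<in> E" "i \<noteq> j"
          then show "c (x i - d - (x j - d)) \<le> c k0 + \<eta>"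
            using x[of i j] EL by (simp add: subset_iff abs_le_iff)
        qed (use bound C_pos \<open>\<gamma> \<le> c k0\<close> \<gamma> eta_pos c0 in auto)
        show "(\<Sum>i\<in>G. \<Sum>j\<in>G. c (x i - x j)) \<le> real (card G) * real (card G) * (c k0 + \<eta> + 2 * C / f)"
          unfolding f_def
        proof (rule sum_off_diagonal_le[OF fG fG ne(2)])
          fix i j assume "i \<in> G" "j \<in> G" "i \<noteq> j"
          then show "c (x i - x j) \<le> c k0 + \<eta>"
            using x[of i j] GL by (simp add: subset_iff abs_le_iff)
        qed (use bound C_pos \<open>\<gamma> \<le> c k0\<close> \<gamma> eta_pos c0 in auto)
        show "real (card E) * real (card G) * (c k0 - \<eta> - 2 * C / e) \<le> (\<Sum>i\<in>E. \<Sum>j\<in>G. c (x i - d - x j))"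
          unfolding e_def
        proof (rule sum_off_diagonal_ge[OF fE fG ne(1)])
          fix i j assume "i \<in> E" "j \<in> G" "i \<noteq> j"
          then show "c k0 - \<eta> \<le> c (x i - d - x j)"
            using xd[of i j] EL GL by (simp add: subset_iff abs_le_iff algebra_simps)
        next
          fix i show "- C \<le> c (x i - d - x i)" using bound[of "x i - d - x i"] by simp
        qed (use k0 C_pos eta_pos in auto)
      qed
      also have "\<dots> = 4 * C * \<eta> + C * (6 * C / e + 2 * C / f)"
        by (simp add: algebra_simps)
      also have "\<dots> \<le> \<gamma>\<^sup>2 / 16 + \<gamma>\<^sup>2 / 8"
      proof -
        have "C * (6 * C / e) \<le> \<gamma>\<^sup>2 * (24 / 256)"
        proof -
          have "256 * C\<^sup>2 \<le> \<gamma>\<^sup>2 * (4 * e)"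
            using L(1) e(2) by (smt (verit) mult_left_mono zero_le_power2)
          then show ?thesis using e by (simp add: field_simps power2_eq_square)
        qed
        moreover have "C * (2 * C / f) \<le> \<gamma>\<^sup>2 * (4 / 256)"
        proof -
          have "256 * C\<^sup>2 \<le> \<gamma>\<^sup>2 * (2 * f)"
            using L(1) f(2) by (smt (verit) mult_left_mono zero_le_power2)
          then show ?thesis using f by (simp add: field_simps power2_eq_square)
        qed
        ultimately have "C * (6 * C / e + 2 * C / f) \<le> \<gamma>\<^sup>2 / 8"
          using half_sq(2) by (subst distrib_left) linarith
        moreover have "4 * C * \<eta> = \<gamma>\<^sup>2 / 16" using \<eta> by simp
        ultimately show ?thesis by linarith
      qed
      finally have up: "((\<Sum>i\<in>E. c (x i - d - z)) / card E - (\<Sum>j\<in>G. c (x j - z)) / card G)\<^sup>2 \<le> \<gamma>\<^sup>2 * (3 / 16)"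
        by simp
      have "\<gamma> / 2 \<le> \<bar>(\<Sum>i\<in>E. c (x i - d - z)) / card E - (\<Sum>j\<in>G. c (x j - z)) / card G\<bar>"
        using meanE meanG eta_le \<gamma> unfolding e_def f_def by linarith
      then have "(\<gamma> / 2)\<^sup>2 \<le> ((\<Sum>i\<in>E. c (x i - d - z)) / card E - (\<Sum>j\<in>G. c (x j - z)) / card G)\<^sup>2"
        using \<gamma> by (metis abs_le_square_iff abs_of_pos half_gt_zero)
      then show False
        using up half_sq by linarith
    qed
  qed
  \<comment> \<open>As \<open>d \<noteq> 0\<close>, each progression meets the support for finitely
    many \<open>k\<close> only. For any other \<open>k\<close> all correlations are 0, at distance
    at least \<open>\<gamma>\<close> from \<open>c k0\<close>.\<close>
  have "finite (\<Union>i<L. (\<lambda>k. x i - (x 0 + int k * d)) -` {j. c j \<noteq> 0})"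
    by (intro finite_UN_I finite_vimageI fin) (use d in \<open>auto simp: inj_on_def\<close>)
  then obtain k where k: "k \<notin> (\<Union>i<L. (\<lambda>k. x i - (x 0 + int k * d)) -` {j. c j \<noteq> 0})"
    using ex_new_if_finite[OF infinite_UNIV_nat] by blast
  have "Bad k = {..<L}"
    using k \<open>\<gamma> \<le> c k0\<close> by (auto simp: Bad_def)
  then show False
    using half[of k] L(2) by simp
qed

end

text \<open>The patterns to be coloured, such as \<open>x a - x b - x i + x j\<close>, depend on the
  order of the indices, so sets are read as increasing lists. The bound \<open>N\<close> precedes
  the colouring, which gives uniformity in \<open>c\<close>.\<close>

lemma ramsey_increasing:
  fixes L q r :: nat
  shows "\<exists>N. \<forall>f::nat list \<Rightarrow> nat. (\<forall>xs. f xs < q) \<longrightarrow>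
     (\<exists>e t. (\<forall>i j. i < j \<longrightarrow> j < L \<longrightarrow> e i < e j) \<and> (\<forall>i<L. e i < N) \<and>
        (\<forall>xs. length xs = r \<longrightarrow> sorted_wrt (<) xs \<longrightarrow> set xs \<subseteq> {..<L} \<longrightarrow> f (map e xs) = t))"
proof -
  obtain N :: nat where N: "partn_lst {..<N} (replicate q L) r"
    using ramsey_full by blast
  show ?thesis
  proof (intro exI[of _ N] allI impI)
    fix f :: "nat list \<Rightarrow> nat" assume f: "\<forall>xs. f xs < q"
    define g where "g = (\<lambda>Y. f (sorted_list_of_set Y))"
    have "g \<in> nsets {..<N} r \<rightarrow> {..<length (replicate q L)}"
      using f by (simp add: g_def)
    then obtain t where t: "t < q" and "monochromatic {..<N} (replicate q L ! t) r g t"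
      using N unfolding partn_lst_def by (metis length_replicate)
    then obtain H where H: "H \<in> nsets {..<N} L" and g: "g ` nsets H r \<subseteq> {t}"
      by (auto simp: monochromatic_def)
    define l where "l = sorted_list_of_set H"
    have H': "H \<subseteq> {..<N}" "finite H" "card H = L" using H by (auto simp: nsets_def)
    have l: "sorted_wrt (<) l" "set l = H" "length l = L"
      using H' by (simp_all add: l_def)
    have inc: "l ! i < l ! j" if "i < j" "j < L" for i j
      using that l sorted_wrt_nth_less by fastforce
    have mem: "l ! i \<in> H" if "i < L" for i
      using that l by auto
    have memN: "l ! i < N" if "i < L" for i
      using mem[OF that] H'(1) by blast
    have "f (map ((!) l) xs) = t"
      if xs: "length xs = r" "sorted_wrt (<) xs" "set xs \<subseteq> {..<L}" for xs
    proof -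
      let ?m = "map ((!) l) xs"
      have s: "sorted_wrt (<) ?m"
        unfolding sorted_wrt_map
        by (rule sorted_wrt_mono_rel[OF _ xs(2)]) (use xs(3) inc in auto)
      then have d: "distinct ?m" "sorted ?m"
        using strict_sorted_iff by blast+
      then have "sorted_list_of_set (set ?m) = ?m"
        by (intro sorted_list_of_set.idem_if_sorted_distinct)
      moreover have "set ?m \<in> nsets H r"
        using distinct_card[OF d(1)] xs mem by (auto simp: nsets_def)
      ultimately show ?thesis
        using g by (auto simp: g_def image_subset_iff)
    qed
    then show "\<exists>e t. (\<forall>i j. i < j \<longrightarrow> j < L \<longrightarrow> e i < e j) \<and> (\<forall>i<L. e i < N) \<and>
        (\<forall>xs. length xs = r \<longrightarrow> sorted_wrt (<) xs \<longrightarrow> set xs \<subseteq> {..<L} \<longrightarrow> f (map e xs) = t)"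
      using inc memN by (intro exI[of _ "(!) l"] exI[of _ t]) auto
  qed
qed

context gapped begin

text \<open>Cells of width \<open>\<gamma> / 2\<close> covering the range from \<open>- C\<close> to
  \<open>C\<close>; two values in one cell differ by less than \<open>\<gamma>\<close>, which the
  gap improves to \<open>\<eta>\<close>.\<close>

definition colour :: "int \<Rightarrow> nat" where "colour z = nat \<lfloor>2 * (c z + C) / \<gamma>\<rfloor>"

lemma colour_less: "colour z < nat \<lfloor>4 * C / \<gamma>\<rfloor> + 1"
proof -
  have "2 * (c z + C) / \<gamma> \<le> 4 * C / \<gamma>"
    using bound[of z] \<gamma> by (intro divide_right_mono) auto
  then show ?thesis
    unfolding colour_def using floor_mono nat_mono by (metis Suc_eq_plus1 less_Suc_eq_le)
qed

lemma colour_close: "colour y = colour z \<Longrightarrow> \<bar>c y - c z\<bar> \<le> \<eta>"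
proof (rule near_close)
  assume eq: "colour y = colour z"
  have nonneg: "0 \<le> \<lfloor>2 * (c w + C) / \<gamma>\<rfloor>" for w
    using bound[of w] \<gamma> by simp
  have "\<lfloor>2 * (c y + C) / \<gamma>\<rfloor> = \<lfloor>2 * (c z + C) / \<gamma>\<rfloor>"
    using eq nonneg by (simp add: colour_def nat_eq_iff)
  then have "\<bar>2 * (c y + C) / \<gamma> - 2 * (c z + C) / \<gamma>\<bar> < 1"
    by linarith
  then have "\<bar>2 * (c y - c z)\<bar> < \<gamma>"
    using \<gamma> by (simp add: divide_simps abs_if split: if_splits)
  then show "\<bar>c y - c z\<bar> < \<gamma>" by (simp add: abs_mult)
qed

text \<open>In the Hilbert space picture a long family of unit vectors with pairwise correlations near
  \<open>c k0\<close> splits as \<open>w + r i\<close> with almost orthogonal \<open>r i\<close>; passing to the differences \<open>s J\<close> replaces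
  the multiplier \<open>w\<close> by \<open>\<bar>w\<bar>\<^sup>2\<close>, which lowers the correlation unless \<open>w\<close> is an idempotent,
  the case excluded by \<open>no_period\<close>.\<close>

lemma clique_descent:
  fixes x :: "nat \<Rightarrow> int" and h :: nat
  defines "s \<equiv> \<lambda>J. x (2 * J) - x (2 * J + 1)"
  assumes h: "256 * C\<^sup>2 \<le> \<gamma>\<^sup>2 * real h" "2 \<le> h" and k0: "\<gamma> \<le> c k0"
    and inj: "inj_on x {..<2 * h + 3}"
    and x: "\<And>i j. i < j \<Longrightarrow> j < 2 * h + 3 \<Longrightarrow> \<bar>c (x i - x j) - c k0\<bar> \<le> \<eta>"
    and A: "\<And>a b i j. a < b \<Longrightarrow> b < i \<Longrightarrow> i < j \<Longrightarrow> j < 2 * h + 3 \<Longrightarrow>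
        \<bar>c (x a - x b - x i + x j) - c kA\<bar> \<le> \<eta>"
    and B: "\<And>a b i j. a < b \<Longrightarrow> b < i \<Longrightarrow> i < j \<Longrightarrow> j < 2 * h + 3 \<Longrightarrow>
        \<bar>c (x a - x b + x i - x j) - c kB\<bar> \<le> \<eta>"
  shows "\<gamma> \<le> c kA" "c kA \<le> c k0 - \<gamma>" "inj_on s {..<h}"
    "\<And>I J. I < h \<Longrightarrow> J < h \<Longrightarrow> I \<noteq> J \<Longrightarrow> \<bar>c (s I - s J) - c kA\<bar> \<le> \<eta>"
proof -
  have x': "\<bar>c (x i - x j) - c k0\<bar> \<le> \<eta>" if "i < 2 * h + 3" "j < 2 * h + 3" "i \<noteq> j" for i j
    using x[of i j] x[of j i] that comm[of "x i" "x j"] by (cases "i < j") auto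
  have hpos: "0 < real h" using h by simp
  have Ch: "C * (C / h) \<le> \<gamma>\<^sup>2 / 256"
    using h(1) hpos by (simp add: field_simps power2_eq_square)
  have Ch': "C / h \<le> \<gamma> / 256"
  proof -
    have "C * (C / h) \<le> C * (\<gamma> / 256)"
      using Ch \<gamma> by (smt (verit) mult_right_mono power2_eq_square times_divide_eq_right divide_right_mono)
    then show ?thesis using mult_le_cancel_left_pos[OF C_pos] by blast
  qed
  have e: "\<eta> \<le> \<gamma> / 64" "0 < \<eta>" using eta_le eta_pos by auto
  have Ce: "C * \<eta> = \<gamma>\<^sup>2 / 64" using \<eta> by simp
  have cb: "- C \<le> c z" "c z \<le> C" for z using bound[of z] by auto
  have within: "(\<Sum>i\<in>F. \<Sum>j\<in>F. c (x i - x j)) \<le> real (card F) * real (card F) * (c k0 + \<eta> + 2 * C / h)"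
    if F: "F \<subseteq> {..<2 * h + 3}" "card F = h" for F
  proof -
    have "finite F" "F \<noteq> {}" using F h finite_subset by auto
    then have "(\<Sum>i\<in>F. \<Sum>j\<in>F. c (x i - x j)) \<le> real (card F) * real (card F) * (c k0 + \<eta> + 2 * C / card F)"
    proof (rule sum_off_diagonal_le[OF _ \<open>finite F\<close>])
      fix i j assume "i \<in> F" "j \<in> F" "i \<noteq> j"
      then show "c (x i - x j) \<le> c k0 + \<eta>"
        using x'[of i j] F(1) by (simp add: subset_iff abs_le_iff)
    qed (use cb C_pos k0 \<gamma> e in auto)
    then show ?thesis by (simp add: F)
  qed
  have ke: "c k0 - \<eta> \<le> C" "c kA - \<eta> \<le> C" using cb[of k0] cb[of kA] e by linarith+
  \<comment> \<open>The same \<open>z\<close> serves both patterns: an index before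
    \<open>h + 2\<close> yields pattern A, one after it pattern B, and the means over the two blocks
    nearly coincide as vectors. Two leading indices, the middle one and two blocks of length
    \<open>h\<close> make up \<open>2 * h + 3\<close>.\<close>
  have AB: "\<bar>c kA - c kB\<bar> \<le> \<eta>"
  proof (rule near_close, rule ccontr)
    assume far: "\<not> \<bar>c kA - c kB\<bar> < \<gamma>"
    define z where "z = x 0 - x 1 + x (h + 2)"
    define E where "E = {2..<h + 2}"
    define G where "G = {h + 3..<2 * h + 3}"
    have [simp]: "finite E" "finite G" "card E = h" "card G = h" "E \<noteq> {}" "G \<noteq> {}"
      using h by (auto simp: E_def G_def)
    have "((\<Sum>i\<in>E. c (x i - z)) / card E - (\<Sum>j\<in>G. c (x j - z)) / card G)\<^sup>2
       \<le> C * ((c k0 + \<eta> + 2 * C / h) + (c k0 + \<eta> + 2 * C / h) - 2 * (c k0 - \<eta> - 2 * C / h))"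
    proof (rule pos_def_two_means[OF pd c0 C_pos])
      show "(\<Sum>i\<in>E. \<Sum>j\<in>E. c (x i - x j)) \<le> real (card E) * real (card E) * (c k0 + \<eta> + 2 * C / h)"
        "(\<Sum>i\<in>G. \<Sum>j\<in>G. c (x i - x j)) \<le> real (card G) * real (card G) * (c k0 + \<eta> + 2 * C / h)"
        by (intro within; auto simp: E_def G_def)+
      have "real (card E) * real (card G) * (c k0 - \<eta> - 2 * C / card E) \<le> (\<Sum>i\<in>E. \<Sum>j\<in>G. c (x i - x j))"
      proof (rule sum_off_diagonal_ge)
        fix i j assume "i \<in> E" "j \<in> G"
        then show "c k0 - \<eta> \<le> c (x i - x j)"
          using x'[of i j] by (simp add: E_def G_def abs_le_iff)
      qed (use C_pos cb ke in auto)
      then show "real (card E) * real (card G) * (c k0 - \<eta> - 2 * C / h) \<le> (\<Sum>i\<in>E. \<Sum>j\<in>G. c (x i - x j))"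
        by simp
    qed auto
    also have "\<dots> = 4 * (C * \<eta>) + 8 * (C * (C / h))"
      by (simp add: algebra_simps)
    also have "\<dots> \<le> \<gamma>\<^sup>2 * (3 / 32)"
      using Ce Ch half_sq(2) by linarith
    finally have up: "((\<Sum>i\<in>E. c (x i - z)) / h - (\<Sum>j\<in>G. c (x j - z)) / h)\<^sup>2 \<le> \<gamma>\<^sup>2 * (3 / 32)"
      by simp
    have mean: "\<bar>(\<Sum>i\<in>F. c (x i - z)) / h - v\<bar> \<le> \<eta>"
      if "finite F" "card F = h" and F: "\<And>i. i \<in> F \<Longrightarrow> \<bar>c (x i - z) - v\<bar> \<le> \<eta>" for F v
    proof -
      have "(\<Sum>i\<in>F. c (x i - z)) \<le> (\<Sum>i\<in>F. v + \<eta>)"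
        by (rule sum_mono) (use F in fastforce)
      moreover have "(\<Sum>i\<in>F. v - \<eta>) \<le> (\<Sum>i\<in>F. c (x i - z))"
        by (rule sum_mono) (use F in fastforce)
      ultimately show ?thesis
        using that hpos by (simp add: abs_le_iff field_simps)
    qed
    have "\<bar>(\<Sum>i\<in>E. c (x i - z)) / h - c kA\<bar> \<le> \<eta>"
    proof (rule mean)
      fix i assume "i \<in> E"
      then show "\<bar>c (x i - z) - c kA\<bar> \<le> \<eta>"
        using A[of 0 1 i "h + 2"] comm[of "x i" z] by (simp add: E_def z_def algebra_simps)
    qed auto
    moreover have "\<bar>(\<Sum>i\<in>G. c (x i - z)) / h - c kB\<bar> \<le> \<eta>"
    proof (rule mean)
      fix i assume "i \<in> G"
      then show "\<bar>c (x i - z) - c kB\<bar> \<le> \<eta>"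
        using B[of 0 1 "h + 2" i] comm[of "x i" z] by (simp add: G_def z_def algebra_simps)
    qed auto
    ultimately have "\<gamma> / 2 \<le> \<bar>(\<Sum>i\<in>E. c (x i - z)) / h - (\<Sum>j\<in>G. c (x j - z)) / h\<bar>"
      using far e \<gamma> by linarith
    then have "(\<gamma> / 2)\<^sup>2 \<le> ((\<Sum>i\<in>E. c (x i - z)) / h - (\<Sum>j\<in>G. c (x j - z)) / h)\<^sup>2"
      using \<gamma> by (metis abs_le_square_iff abs_of_pos half_gt_zero)
    then show False
      using up half_sq by linarith
  qed
  have B': "\<bar>c (x a - x b + x i - x j) - c kA\<bar> \<le> \<eta>" if "a < b" "b < i" "i < j" "j < 2 * h + 3" for a b i j
    using B[OF that] AB e \<gamma> by (intro near_close) linarith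
  \<comment> \<open>A difference of two later members: for \<open>i < j\<close> the number
    \<open>x i - x j - d\<close> has pattern B, for \<open>j < i\<close> its negative has pattern A.
    This is what the identification of A with B is for.\<close>
  define d where "d = x (h + 1) - x h"
  have xd: "\<bar>c (x i - x j - d) - c kA\<bar> \<le> \<eta>" if "i < h" "j < h" "i \<noteq> j" for i j
  proof (cases "i < j")
    case True
    then show ?thesis
      using B'[of i j h "h + 1"] that by (simp add: d_def algebra_simps)
  next
    case False
    have "c (x i - x j - d) = c (x j - x i - x h + x (h + 1))"
      using pos_def_minus[OF pd, of "x i - x j - d"] by (simp add: d_def algebra_simps)
    then show ?thesis
      using A[of j i h "h + 1"] that False by (simp add: d_def)
  qed
  \<comment> \<open>Up to small errors \<open>c kA\<close> is the inner product of the mean of the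
    \<open>x i\<close> with its translate by \<open>d\<close>, and both have squared norm about
    \<open>c k0\<close>.\<close>
  have up: "c kA < c k0 + \<gamma>"
  proof -
    define E where "E = {..<h}"
    have "0 \<in> E" using h(2) by (simp add: E_def)
    then have [simp]: "finite E" "card E = h" "E \<noteq> {}"
      by (auto simp: E_def)
    have EE: "(\<Sum>i\<in>E. \<Sum>j\<in>E. c (x i - x j)) \<le> real (card E) * real (card E) * (c k0 + \<eta> + 2 * C / h)"
      by (rule within) (auto simp: E_def)
    have "real (card E) * real (card E) * (c kA - \<eta> - 2 * C / card E) \<le> (\<Sum>i\<in>E. \<Sum>j\<in>E. c (x i - (x j + d)))"
    proof (rule sum_off_diagonal_ge)
      fix i j assume "i \<in> E" "j \<in> E" "i \<noteq> j"
      then show "c kA - \<eta> \<le> c (x i - (x j + d))"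
        using xd[of i j] by (simp add: E_def abs_le_iff algebra_simps)
    qed (use C_pos cb ke in auto)
    then have ED: "real (card E) * real (card E) * (c kA - \<eta> - 2 * C / h) \<le> (\<Sum>i\<in>E. \<Sum>j\<in>E. c (x i - (x j + d)))"
      by simp
    have "0 \<le> ((\<Sum>i\<in>E. c (x i - 0)) / card E - (\<Sum>j\<in>E. c (x j + d - 0)) / card E)\<^sup>2"
      by simp
    also have "\<dots> \<le> C * ((c k0 + \<eta> + 2 * C / h) + (c k0 + \<eta> + 2 * C / h) - 2 * (c kA - \<eta> - 2 * C / h))"
      by (rule pos_def_two_means[OF pd c0 C_pos]) (use EE ED in auto)
    finally have "0 \<le> (c k0 + \<eta> + 2 * C / h) + (c k0 + \<eta> + 2 * C / h) - 2 * (c kA - \<eta> - 2 * C / h)"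
      by (metis C_pos mult_le_cancel_left_pos mult_zero_right)
    then have "c kA \<le> c k0 + 2 * \<eta> + 2 * (2 * C / h)"
      by simp
    moreover have "2 * C / h \<le> \<gamma> / 128" using Ch' by (simp add: mult.commute)
    ultimately show ?thesis
      using e \<gamma> by linarith
  qed
  show s: "\<bar>c (s I - s J) - c kA\<bar> \<le> \<eta>" if "I < h" "J < h" "I \<noteq> J" for I J
  proof -
    have *: "\<bar>c (s I - s J) - c kA\<bar> \<le> \<eta>" if "I < J" "J < h" for I J
      using A[of "2 * I" "2 * I + 1" "2 * J" "2 * J + 1"] that by (simp add: s_def algebra_simps)
    show ?thesis
      using *[of I J] *[of J I] that comm[of "s I" "s J"] by (cases "I < J") auto
  qed
  \<comment> \<open>Otherwise the \<open>s J\<close> are pairwise almost orthogonal or negatively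
    correlated, while each has correlation about \<open>c k0\<close> with the vector at 0. Bessel's
    inequality forbids this.\<close>
  show kA: "\<gamma> \<le> c kA"
  proof (rule ccontr)
    assume "\<not> \<gamma> \<le> c kA"
    then have small: "c kA \<le> \<eta>" using gap_zero[of kA] e by auto
    have "h * (c k0 - \<eta>) \<le> (\<Sum>J<h. c (s J - 0))"
    proof -
      have "(\<Sum>J<h. c k0 - \<eta>) \<le> (\<Sum>J<h. c (s J - 0))"
      proof (rule sum_mono)
        fix J assume "J \<in> {..<h}"
        then show "c k0 - \<eta> \<le> c (s J - 0)"
          using x[of "2 * J" "2 * J + 1"] by (simp add: s_def abs_le_iff)
      qed
      then show ?thesis by simp
    qed
    then have "(h * (\<gamma> / 2))\<^sup>2 \<le> (\<Sum>J<h. 1 * c (s J - 0))\<^sup>2"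
      using k0 e \<gamma> hpos by (intro power_mono order_trans[OF mult_left_mono, of "\<gamma> / 2" "c k0 - \<eta>"]) auto
    also have "\<dots> \<le> C * (\<Sum>I<h. \<Sum>J<h. 1 * 1 * c (s I - s J))"
      by (rule pos_def_Cauchy_Schwarz[OF pd _ c0 C_pos]) simp
    also have "\<dots> \<le> C * (real h * real h * (2 * \<eta> + 2 * C / h))"
    proof (rule mult_left_mono)
      have "(\<Sum>I<h. \<Sum>J<h. c (s I - s J)) \<le> real (card {..<h}) * real (card {..<h}) * (2 * \<eta> + 2 * C / card {..<h})"
      proof (rule sum_off_diagonal_le)
        fix I J assume "I \<in> {..<h}" "J \<in> {..<h}" "I \<noteq> J"
        then show "c (s I - s J) \<le> 2 * \<eta>"
          using s[of I J] small by simp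
      next
        have "0 \<in> {..<h}" using h(2) by simp
        then show "{..<h} \<noteq> {}" by blast
      qed (use C_pos e cb in auto)
      then show "(\<Sum>I<h. \<Sum>J<h. 1 * 1 * c (s I - s J)) \<le> real h * real h * (2 * \<eta> + 2 * C / h)"
        by simp
    qed (use C_pos in simp)
    also have "\<dots> = (real h)\<^sup>2 * (2 * (C * \<eta>) + 2 * (C * (C / h)))"
      by (simp add: algebra_simps power2_eq_square)
    also have "\<dots> \<le> (real h)\<^sup>2 * (\<gamma>\<^sup>2 * (5 / 128))"
      using Ce Ch by (intro mult_left_mono) (linarith, simp)
    finally have "(real h)\<^sup>2 * (\<gamma> / 2)\<^sup>2 \<le> (real h)\<^sup>2 * (\<gamma>\<^sup>2 * (5 / 128))"
      by (simp only: power_mult_distrib)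
    then have "(\<gamma> / 2)\<^sup>2 \<le> \<gamma>\<^sup>2 * (5 / 128)"
      using hpos by simp
    then show False
      using half_sq by linarith
  qed
  \<comment> \<open>By the gap and \<open>up\<close>, the alternative is that \<open>c kA\<close> is
    close to \<open>c k0\<close>; then translation by \<open>d\<close> preserves the correlations,
    which \<open>no_period\<close> excludes.\<close>
  show kAk0: "c kA \<le> c k0 - \<gamma>"
  proof (rule ccontr)
    assume "\<not> ?thesis"
    then have "\<bar>c kA - c k0\<bar> \<le> \<eta>"
      using up by (intro near_close) auto
    moreover have "\<bar>c (x i - x j - d) - c kA\<bar> \<le> \<eta>" if "i < h" "j < h" "i \<noteq> j" for i j
      using xd that by blast
    ultimately have "\<bar>c (x i - x j - d) - c k0\<bar> \<le> \<eta>" if "i < h" "j < h" "i \<noteq> j" for i j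
      using that e \<gamma> by (intro near_close) fastforce
    moreover have "d \<noteq> 0"
      using inj_onD[OF inj, of "h + 1" h] by (auto simp: d_def)
    ultimately show False
      using no_period[of h d k0 x] h k0 x' by simp
  qed
  show "inj_on s {..<h}"
  proof (rule inj_onI, rule ccontr)
    fix I J assume IJ: "I \<in> {..<h}" "J \<in> {..<h}" "s I = s J" "I \<noteq> J"
    \<comment> \<open>Weights 1 and -1 at \<open>k0\<close> and 0. If two of the \<open>s\<close>
      coincided, \<open>c 0\<close> would be close to \<open>c kA\<close>, which lies below
      \<open>c k0\<close> by \<open>\<gamma>\<close>.\<close>
    have "c k0 \<le> c 0"
      using pos_def_sum[OF pd, of "{False, True}" "\<lambda>b. if b then 1 else - 1" "\<lambda>b. if b then k0 else 0"]
        pos_def_minus[OF pd, of k0] by simp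
    then show False
      using s[of I J] IJ kA kAk0 e \<gamma> by auto
  qed
qed

end

text \<open>Induction on the height of the common correlation in units of \<open>\<gamma>\<close>,
  since \<open>clique_descent\<close> turns a long family into a lower one. At \<open>k = 0\<close>
  the two bounds on \<open>c k0\<close> conflict. \<open>L\<close> is chosen before \<open>c\<close>
  and so serves every sequence with these parameters.\<close>

lemma no_long_clique:
  fixes C \<gamma> \<eta> :: real
  shows "\<exists>L::nat. \<forall>c (x::nat \<Rightarrow> int) k0. gapped c C \<gamma> \<eta> \<longrightarrow> inj_on x {..<L} \<longrightarrow> \<gamma> \<le> c k0 \<longrightarrow> c k0 \<le> real k * \<gamma> \<longrightarrow>
    (\<forall>i<L. \<forall>j<L. i \<noteq> j \<longrightarrow> \<bar>c (x i - x j) - c k0\<bar> \<le> \<eta>) \<longrightarrow> False"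
proof (induction k)
  case 0
  show ?case
    by (rule exI[of _ 0]) (auto dest!: gapped.\<gamma>(1))
next
  case (Suc k)
  then obtain L0 :: nat where L0: "\<And>c (x::nat \<Rightarrow> int) k0. gapped c C \<gamma> \<eta> \<Longrightarrow> inj_on x {..<L0} \<Longrightarrow> \<gamma> \<le> c k0 \<Longrightarrow> c k0 \<le> real k * \<gamma> \<Longrightarrow>
    (\<forall>i<L0. \<forall>j<L0. i \<noteq> j \<longrightarrow> \<bar>c (x i - x j) - c k0\<bar> \<le> \<eta>) \<Longrightarrow> False"
    by metis
  \<comment> \<open>\<open>L0\<close> leaves enough differences for the induction hypothesis; the
    last entry is the length that \<open>clique_descent\<close> demands.\<close>
  define h where "h = Max {L0, 2, nat \<lceil>256 * C\<^sup>2 / \<gamma>\<^sup>2\<rceil>}"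
  have h: "L0 \<le> h" "2 \<le> h" "nat \<lceil>256 * C\<^sup>2 / \<gamma>\<^sup>2\<rceil> \<le> h"
    unfolding h_def by (rule Max_ge; simp)+
  define Q where "Q = nat \<lfloor>4 * C / \<gamma>\<rfloor> + 1"
  obtain N where N: "\<And>f :: nat list \<Rightarrow> nat. (\<And>xs. f xs < Q * Q) \<Longrightarrow>
     (\<exists>e t. (\<forall>i j. i < j \<longrightarrow> j < 2 * h + 3 \<longrightarrow> e i < e j) \<and> (\<forall>i<2 * h + 3. e i < N) \<and>
        (\<forall>xs. length xs = 4 \<longrightarrow> sorted_wrt (<) xs \<longrightarrow> set xs \<subseteq> {..<2 * h + 3} \<longrightarrow> f (map e xs) = t))"
    using ramsey_increasing[of "Q * Q" "2 * h + 3" 4] by metis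
  show ?case
  proof (intro exI[of _ N] allI impI)
    fix c k0 and x :: "nat \<Rightarrow> int"
    assume "gapped c C \<gamma> \<eta>" and inj: "inj_on x {..<N}" and k0: "\<gamma> \<le> c k0" "c k0 \<le> real (Suc k) * \<gamma>"
      and x: "\<forall>i<N. \<forall>j<N. i \<noteq> j \<longrightarrow> \<bar>c (x i - x j) - c k0\<bar> \<le> \<eta>"
    then interpret gapped c C \<gamma> \<eta> by simp
    have "256 * C\<^sup>2 / \<gamma>\<^sup>2 \<le> real h" using h(3) by linarith
    then have h': "256 * C\<^sup>2 \<le> \<gamma>\<^sup>2 * real h"
      using \<gamma> by (simp add: field_simps)
    define pA where "pA = (\<lambda>y::nat\<Rightarrow>int. \<lambda>xs::nat list. y (xs ! 0) - y (xs ! 1) - y (xs ! 2) + y (xs ! 3))"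
    define pB where "pB = (\<lambda>y::nat\<Rightarrow>int. \<lambda>xs::nat list. y (xs ! 0) - y (xs ! 1) + y (xs ! 2) - y (xs ! 3))"
    \<comment> \<open>One colour stores both patterns; \<open>div\<close> and \<open>mod\<close> by
      \<open>Q\<close> recover them.\<close>
    define f where "f = (\<lambda>xs. colour (pA x xs) * Q + colour (pB x xs))"
    have cQ: "colour z < Q" for z
      using colour_less by (simp add: Q_def)
    have "f xs < Q * Q" for xs
    proof -
      have "f xs < colour (pA x xs) * Q + Q" using cQ by (simp add: f_def)
      also have "\<dots> = Suc (colour (pA x xs)) * Q" by simp
      also have "\<dots> \<le> Q * Q" using cQ by (intro mult_le_mono1) (simp add: Suc_le_eq)
      finally show ?thesis .
    qed
    then obtain e t where e: "\<And>i j. i < j \<Longrightarrow> j < 2 * h + 3 \<Longrightarrow> e i < e j" "\<And>i. i < 2 * h + 3 \<Longrightarrow> e i < N"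
      and t: "\<And>xs. length xs = 4 \<Longrightarrow> sorted_wrt (<) xs \<Longrightarrow> set xs \<subseteq> {..<2 * h + 3} \<Longrightarrow> f (map e xs) = t"
      using N[of f] by metis
    define y where "y = x \<circ> e"
    have col: "colour (pA y [a, b, i, j]) = t div Q \<and> colour (pB y [a, b, i, j]) = t mod Q"
      if "a < b" "b < i" "i < j" "j < 2 * h + 3" for a b i j
    proof -
      have "f (map e [a, b, i, j]) = t"
        by (rule t) (use that in auto)
      then have "t = colour (pA y [a, b, i, j]) * Q + colour (pB y [a, b, i, j])"
        by (simp add: f_def pA_def pB_def y_def numeral_2_eq_2 numeral_3_eq_3)
      then show ?thesis
        using cQ[of "pA y [a, b, i, j]"] cQ[of "pB y [a, b, i, j]"] by simp
    qed
    define kA where "kA = pA y [0, 1, 2, 3]"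
    define kB where "kB = pB y [0, 1, 2, 3]"
    have A: "\<bar>c (y a - y b - y i + y j) - c kA\<bar> \<le> \<eta>" and B: "\<bar>c (y a - y b + y i - y j) - c kB\<bar> \<le> \<eta>"
      if "a < b" "b < i" "i < j" "j < 2 * h + 3" for a b i j
      using colour_close[of "pA y [a, b, i, j]" kA] colour_close[of "pB y [a, b, i, j]" kB]
        col[OF that] col[of 0 1 2 3] h(2)
      by (simp_all add: kA_def kB_def pA_def pB_def numeral_2_eq_2 numeral_3_eq_3)
    have inje: "inj_on y {..<2 * h + 3}"
    proof -
      have "inj_on e {..<2 * h + 3}"
        by (rule inj_onI) (metis e(1) lessThan_iff less_irrefl linorder_neqE_nat)
      then show ?thesis
        unfolding y_def by (rule comp_inj_on) (rule inj_on_subset[OF inj], use e(2) in auto)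
    qed
    have yy: "\<bar>c (y i - y j) - c k0\<bar> \<le> \<eta>" if "i < j" "j < 2 * h + 3" for i j
      using x e(1)[OF that] e(2)[of i] e(2)[of j] that by (auto simp: y_def)
    note desc = clique_descent[OF h' h(2) k0(1) inje yy A B]
    have "c kA \<le> real k * \<gamma>"
      using desc(2) k0(2) by (simp add: algebra_simps)
    moreover have "inj_on (\<lambda>J. y (2 * J) - y (2 * J + 1)) {..<L0}"
      by (rule inj_on_subset[OF desc(3)]) (use h(1) in auto)
    ultimately show False
      using L0[OF gapped_axioms _ desc(1)] desc(4) h(1) by fastforce
  qed
qed

text \<open>Among many large values Ramsey's theorem finds a family with a common correlation. A
  large positive one contradicts \<open>no_long_clique\<close>, a small one Bessel's inequality with
  the vector at 0, and a large negative one would give the sum of the family a negative squared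
  norm.\<close>

lemma gapped_few_large_values:
  fixes C \<gamma> \<eta> :: real
  shows "\<exists>N. \<forall>c. gapped c C \<gamma> \<eta> \<longrightarrow> card {j. \<gamma> \<le> \<bar>c j\<bar>} \<le> N"
proof -
  obtain L0 :: nat where L0: "\<And>c (x::nat \<Rightarrow> int) k0. gapped c C \<gamma> \<eta> \<Longrightarrow> inj_on x {..<L0} \<Longrightarrow> \<gamma> \<le> c k0 \<Longrightarrow>
      c k0 \<le> real (nat \<lceil>C / \<gamma>\<rceil>) * \<gamma> \<Longrightarrow>
    (\<forall>i<L0. \<forall>j<L0. i \<noteq> j \<longrightarrow> \<bar>c (x i - x j) - c k0\<bar> \<le> \<eta>) \<Longrightarrow> False"
    using no_long_clique[of C \<gamma> \<eta> "nat \<lceil>C / \<gamma>\<rceil>"] by metis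
  define h where "h = Max {L0, 2, nat \<lceil>256 * C\<^sup>2 / \<gamma>\<^sup>2\<rceil>}"
  have h: "L0 \<le> h" "2 \<le> h" "nat \<lceil>256 * C\<^sup>2 / \<gamma>\<^sup>2\<rceil> \<le> h"
    unfolding h_def by (rule Max_ge; simp)+
  define Q where "Q = nat \<lfloor>4 * C / \<gamma>\<rfloor> + 1"
  obtain N where N: "\<And>f :: nat list \<Rightarrow> nat. (\<And>xs. f xs < Q) \<Longrightarrow>
     (\<exists>e t. (\<forall>i j. i < j \<longrightarrow> j < h \<longrightarrow> e i < e j) \<and> (\<forall>i<h. e i < N) \<and>
        (\<forall>xs. length xs = 2 \<longrightarrow> sorted_wrt (<) xs \<longrightarrow> set xs \<subseteq> {..<h} \<longrightarrow> f (map e xs) = t))"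
    using ramsey_increasing[of Q h 2] by metis
  show ?thesis
  proof (intro exI[of _ N] allI impI, rule ccontr)
    fix c assume "gapped c C \<gamma> \<eta>" and big: "\<not> card {j. \<gamma> \<le> \<bar>c j\<bar>} \<le> N"
    then interpret gapped c C \<gamma> \<eta> by simp
    define \<Lambda> where "\<Lambda> = {j. \<gamma> \<le> \<bar>c j\<bar>}"
    have "\<Lambda> \<subseteq> {j. c j \<noteq> 0}" using \<gamma> by (auto simp: \<Lambda>_def)
    then have "finite \<Lambda>" using fin finite_subset by blast
    then obtain e0 where "bij_betw e0 {..<card \<Lambda>} \<Lambda>"
      using ex_bij_betw_nat_finite lessThan_atLeast0 by metis
    then have e0: "inj_on e0 {..<N}" "\<And>i. i < N \<Longrightarrow> \<gamma> \<le> \<bar>c (e0 i)\<bar>"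
      using big by (auto simp: bij_betw_def \<Lambda>_def inj_on_def)
    have "256 * C\<^sup>2 / \<gamma>\<^sup>2 \<le> real h" using h(3) by linarith
    then have h': "256 * C\<^sup>2 \<le> \<gamma>\<^sup>2 * real h"
      using \<gamma> by (simp add: field_simps)
    have hpos: "0 < real h" using h by simp
    have Ch: "C * (C / h) \<le> \<gamma>\<^sup>2 / 256"
      using h' hpos by (simp add: field_simps power2_eq_square)
    have Ch': "C / h \<le> \<gamma> / 256"
    proof -
      have "C * (C / h) \<le> C * (\<gamma> / 256)"
        using Ch \<gamma> by (smt (verit) mult_right_mono power2_eq_square times_divide_eq_right divide_right_mono)
      then show ?thesis using mult_le_cancel_left_pos[OF C_pos] by blast
    qed
    define f where "f = (\<lambda>xs::nat list. colour (e0 (xs ! 0) - e0 (xs ! 1)))"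
    have "f xs < Q" for xs
      using colour_less by (simp add: f_def Q_def)
    then obtain e t where e: "\<And>i j. i < j \<Longrightarrow> j < h \<Longrightarrow> e i < e j" "\<And>i. i < h \<Longrightarrow> e i < N"
      and t: "\<And>xs. length xs = 2 \<Longrightarrow> sorted_wrt (<) xs \<Longrightarrow> set xs \<subseteq> {..<h} \<Longrightarrow> f (map e xs) = t"
      using N[of f] by metis
    define x where "x = e0 \<circ> e"
    have col: "colour (x i - x j) = t" if "i < j" "j < h" for i j
      using t[of "[i, j]"] that by (simp add: f_def x_def)
    define k0 where "k0 = x 0 - x 1"
    have xl: "\<bar>c (x i - x j) - c k0\<bar> \<le> \<eta>" if "i < j" "j < h" for i j
      by (rule colour_close) (use col[OF that] col[of 0 1] h(2) in \<open>simp add: k0_def\<close>)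
    have xx: "\<bar>c (x i - x j) - c k0\<bar> \<le> \<eta>" if "i < h" "j < h" "i \<noteq> j" for i j
      using xl[of i j] xl[of j i] that comm[of "x i" "x j"] by (cases "i < j") auto
    have injx: "inj_on x {..<h}"
    proof -
      have "inj_on e {..<h}"
        by (rule inj_onI) (metis e(1) lessThan_iff less_irrefl linorder_neqE_nat)
      then show ?thesis
        unfolding x_def by (rule comp_inj_on) (rule inj_on_subset[OF e0(1)], use e(2) in auto)
    qed
    have large: "\<gamma> \<le> \<bar>c (x i)\<bar>" if "i < h" for i
      using e0(2) e(2) that by (simp add: x_def)
    have cb: "- C \<le> c z" "c z \<le> C" for z using bound[of z] by auto
    have "0 \<in> {..<h}" using h(2) by simp
    then have ne: "{..<h} \<noteq> {}" by blast
    have et: "\<eta> \<le> \<gamma> / 64" "0 < \<eta>" using eta_le eta_pos by auto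
    consider "\<gamma> \<le> c k0" | "\<bar>c k0\<bar> \<le> \<eta>" | "c k0 \<le> - \<gamma>"
      using gap_zero[of k0] by linarith
    then show False
    proof cases
      case 1
      have "c k0 \<le> C / \<gamma> * \<gamma>" using cb(2)[of k0] \<gamma> by simp
      also have "\<dots> \<le> real (nat \<lceil>C / \<gamma>\<rceil>) * \<gamma>"
        using \<gamma> by (intro mult_right_mono) linarith+
      finally show False
        using L0[OF gapped_axioms inj_on_subset[OF injx] 1] xx h(1) by fastforce
    next
      case 2
      \<comment> \<open>The signs make the correlations with the vector at 0 add up, and leave the
        mutual correlations small.\<close>
      define g where "g = (\<lambda>i. sgn (c (x i)))"
      have g: "\<bar>g i * g j\<bar> \<le> 1" for i j by (simp add: g_def abs_mult sgn_if)
      have "h * \<gamma> \<le> (\<Sum>i<h. g i * c (x i - 0))"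
      proof -
        have "(\<Sum>i<h. \<gamma>) \<le> (\<Sum>i<h. g i * c (x i - 0))"
        proof (rule sum_mono)
          fix i assume "i \<in> {..<h}"
          then show "\<gamma> \<le> g i * c (x i - 0)"
            using large[of i] by (simp add: g_def sgn_if abs_if split: if_splits)
        qed
        then show ?thesis by simp
      qed
      then have "(h * \<gamma>)\<^sup>2 \<le> (\<Sum>i<h. g i * c (x i - 0))\<^sup>2"
        using \<gamma> by (intro power_mono) auto
      also have "\<dots> \<le> C * (\<Sum>i<h. \<Sum>j<h. g i * g j * c (x i - x j))"
        by (rule pos_def_Cauchy_Schwarz[OF pd _ c0 C_pos]) simp
      also have "\<dots> \<le> C * (real (card {..<h}) * real (card {..<h}) * (2 * \<eta> + 2 * C / card {..<h}))"
      proof (intro mult_left_mono sum_off_diagonal_le)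
        have *: "g i * g j * c z \<le> \<bar>c z\<bar>" for i j z
        proof -
          have "g i * g j * c z \<le> \<bar>g i * g j\<bar> * \<bar>c z\<bar>" by (metis abs_ge_self abs_mult)
          also have "\<dots> \<le> 1 * \<bar>c z\<bar>" by (rule mult_right_mono[OF g]) simp
          finally show ?thesis by simp
        qed
        show "g i * g i * c (x i - x i) \<le> C" for i
          using *[of i i "x i - x i"] bound[of "x i - x i"] by linarith
        fix i j assume "i \<in> {..<h}" "j \<in> {..<h}" "i \<noteq> j"
        then have "\<bar>c (x i - x j)\<bar> \<le> 2 * \<eta>"
          using xx[of i j] 2 by simp
        then show "g i * g j * c (x i - x j) \<le> 2 * \<eta>"
          using *[of i j "x i - x j"] by linarith
      qed (use C_pos et ne in auto)
      also have "\<dots> = (real h)\<^sup>2 * (2 * (C * \<eta>) + 2 * (C * (C / h)))"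
        by (simp add: algebra_simps power2_eq_square)
      also have "\<dots> \<le> (real h)\<^sup>2 * (\<gamma>\<^sup>2 / 2)"
      proof (rule mult_left_mono)
        have "C * \<eta> = \<gamma>\<^sup>2 / 64" using \<eta> by simp
        then show "2 * (C * \<eta>) + 2 * (C * (C / h)) \<le> \<gamma>\<^sup>2 / 2"
          using Ch half_sq(2) by linarith
      qed simp
      finally have "(real h)\<^sup>2 * \<gamma>\<^sup>2 \<le> (real h)\<^sup>2 * (\<gamma>\<^sup>2 / 2)"
        by (simp add: power_mult_distrib)
      then show False
        using hpos half_sq(2) by simp
    next
      case 3
      have "0 \<le> (\<Sum>i<h. \<Sum>j<h. 1 * 1 * c (x i - x j))"
        by (rule pos_def_sum[OF pd]) simp
      also have "\<dots> = (\<Sum>i<h. \<Sum>j<h. c (x i - x j))" by simp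
      also have "\<dots> \<le> real (card {..<h}) * real (card {..<h}) * (c k0 + \<eta> + 2 * C / card {..<h})"
      proof (rule sum_off_diagonal_le)
        fix i j assume "i \<in> {..<h}" "j \<in> {..<h}" "i \<noteq> j"
        then show "c (x i - x j) \<le> c k0 + \<eta>"
          using xx[of i j] by simp
      next
        show "- C \<le> c k0 + \<eta>" using cb(1)[of k0] et by linarith
      qed (use C_pos ne cb in auto)
      finally have "0 \<le> real h * real h * (c k0 + \<eta> + 2 * C / h)" by simp
      moreover have "0 < real h * real h" using hpos by simp
      ultimately have "0 \<le> c k0 + \<eta> + 2 * C / h"
        by (metis mult_le_cancel_left_pos mult_zero_right)
      moreover have "2 * C / h \<le> \<gamma> / 128" using Ch' by (simp add: mult.commute)
      ultimately show False
        using 3 et \<gamma> by linarith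
    qed
  qed
qed

text \<open>The pigeonhole behind three choices: a gap between values, an interval without zeros,
  and a scale for the clumps.\<close>

lemma disjoint_family_avoids:
  assumes D: "finite D" "card D \<le> k" and A: "\<And>i j. i \<noteq> j \<Longrightarrow> A i \<inter> A j = {}"
  shows "\<exists>i\<le>k. \<forall>d\<in>D. d \<notin> A (i::nat)"
proof (rule ccontr)
  assume "\<not> ?thesis"
  then obtain d where d: "\<And>i. i \<le> k \<Longrightarrow> d i \<in> D \<and> d i \<in> A i"
    by metis
  have "inj_on d {..k}"
    by (rule inj_onI) (metis A d atMost_iff disjoint_iff)
  then have "card {..k} \<le> card D"
    using d by (intro card_inj_on_le[OF _ _ D(1)]) auto
  then show False using D(2) by simp
qed

text \<open>Here the gap is found rather than assumed: at most \<open>k * k\<close> distances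
  between values miss one of \<open>k * k + 1\<close> disjoint intervals from
  \<open>\<tau> (Suc i)\<close> to \<open>\<tau> i\<close>. Summing the bounds over all these
  \<open>i\<close> removes the dependence on \<open>c\<close>.\<close>

lemma pos_def_few_large_values:
  fixes C \<gamma> :: real
  assumes "0 < \<gamma>"
  shows "\<exists>N. \<forall>c. pos_def c \<longrightarrow> finite {j. c j \<noteq> 0} \<longrightarrow> c 0 \<le> C \<longrightarrow> card (range c) \<le> k \<longrightarrow>
    card {j. \<gamma> \<le> \<bar>c j\<bar>} \<le> N"
proof -
  define C' where "C' = max C \<gamma>"
  \<comment> \<open>The recursion is the relation between \<open>\<gamma>\<close> and
    \<open>\<eta>\<close> in \<open>gapped\<close>. The scales decrease from
    \<open>\<gamma>\<close>, so a count at scale \<open>\<tau> i\<close> dominates the count at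
    \<open>\<gamma>\<close>.\<close>
  define \<tau> where "\<tau> = rec_nat \<gamma> (\<lambda>_ t. t\<^sup>2 / (64 * C'))"
  have \<tau>_Suc: "\<tau> (Suc i) = (\<tau> i)\<^sup>2 / (64 * C')" for i by (simp add: \<tau>_def)
  have C': "0 < C'" "\<gamma> \<le> C'" "C \<le> C'" using assms by (auto simp: C'_def)
  have \<tau>: "0 < \<tau> i \<and> \<tau> i \<le> \<gamma>" for i
  proof (induction i)
    case 0 then show ?case using assms by (simp add: \<tau>_def)
  next
    case (Suc i)
    have "(\<tau> i)\<^sup>2 \<le> \<gamma> * (64 * C')"
      using Suc C' assms unfolding power2_eq_square by (intro mult_mono) auto
    then show ?case using Suc C' by (simp add: \<tau>_Suc field_simps)
  qed
  have "\<tau> (Suc i) \<le> \<tau> i" for i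
  proof -
    have "(\<tau> i)\<^sup>2 \<le> \<tau> i * (64 * C')"
      using \<tau>[of i] C' unfolding power2_eq_square by (intro mult_mono) auto
    then show ?thesis using C' by (simp add: \<tau>_Suc field_simps)
  qed
  then have dec': "\<tau> j \<le> \<tau> i" if "i \<le> j" for i j
    using that by (rule lift_Suc_antimono_le)
  have "\<exists>N. \<forall>c. gapped c C' (\<tau> i) (\<tau> (Suc i)) \<longrightarrow> card {j. \<tau> i \<le> \<bar>c j\<bar>} \<le> N" for i
    by (rule gapped_few_large_values)
  then obtain N where N: "\<And>i c. gapped c C' (\<tau> i) (\<tau> (Suc i)) \<Longrightarrow> card {j. \<tau> i \<le> \<bar>c j\<bar>} \<le> N i"
    by metis
  show ?thesis
  proof (intro exI[of _ "\<Sum>i\<le>k * k. N i"] allI impI)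
    fix c assume c: "pos_def c" "finite {j. c j \<noteq> 0}" "c 0 \<le> C" "card (range c) \<le> k"
    define D where "D = (\<lambda>(u, v). \<bar>u - v\<bar>) ` (range c \<times> range c)"
    have "range c \<subseteq> insert 0 (c ` {j. c j \<noteq> 0})" by auto
    then have fr: "finite (range c)" using c(2) finite_subset by blast
    then have "finite D" by (simp add: D_def)
    moreover have "card D \<le> k * k"
    proof -
      have "card D \<le> card (range c \<times> range c)"
        unfolding D_def by (rule card_image_le) (use fr in simp)
      also have "\<dots> \<le> k * k" using c(4) by (simp add: card_cartesian_product mult_le_mono)
      finally show ?thesis .
    qed
    moreover have "{\<tau> (Suc i)<..<\<tau> i} \<inter> {\<tau> (Suc j)<..<\<tau> j} = {}" if "i \<noteq> j" for i j
      using dec'[of "Suc i" j] dec'[of "Suc j" i] that by (cases "i < j") fastforce+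
    ultimately obtain i where i: "i \<le> k * k" "\<forall>d\<in>D. d \<notin> {\<tau> (Suc i)<..<\<tau> i}"
      using disjoint_family_avoids[of D "k * k" "\<lambda>i. {\<tau> (Suc i)<..<\<tau> i}"] by blast
    have "gapped c C' (\<tau> i) (\<tau> (Suc i))"
    proof
      fix a b
      have "\<bar>c a - c b\<bar> \<in> D" by (force simp: D_def)
      then show "\<bar>c a - c b\<bar> \<le> \<tau> (Suc i) \<or> \<tau> i \<le> \<bar>c a - c b\<bar>"
        using i(2) by force
    qed (use c C' \<tau>[of i] in \<open>auto simp: \<tau>_Suc\<close>)
    then have "card {j. \<tau> i \<le> \<bar>c j\<bar>} \<le> N i" by (rule N)
    moreover have "card {j. \<gamma> \<le> \<bar>c j\<bar>} \<le> card {j. \<tau> i \<le> \<bar>c j\<bar>}"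
    proof (rule card_mono)
      have "{j. \<tau> i \<le> \<bar>c j\<bar>} \<subseteq> {j. c j \<noteq> 0}" using \<tau>[of i] by auto
      then show "finite {j. \<tau> i \<le> \<bar>c j\<bar>}" using c(2) finite_subset by blast
    qed (use \<tau>[of i] in auto)
    moreover have "N i \<le> (\<Sum>i\<le>k * k. N i)"
      using i(1) by (intro member_le_sum) auto
    ultimately show "card {j. \<gamma> \<le> \<bar>c j\<bar>} \<le> (\<Sum>i\<le>k * k. N i)" by linarith
  qed
qed

section \<open>Cosine sums of constant sign\<close>

lemma has_integral_cos_int:
  "((\<lambda>t. cos (of_int m * t)) has_integral (if m = 0 then 2 * pi else 0)) {0..2 * pi}"
proof (cases "m = 0")
  case True
  then show ?thesis using has_integral_const_real[of "1::real" 0 "2 * pi"] by simp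
next
  case False
  have "((\<lambda>t. cos (of_int m * t)) has_integral (sin (of_int m * (2 * pi)) / of_int m - sin (of_int m * 0) / of_int m)) {0..2 * pi}"
    by (rule fundamental_theorem_of_calculus)
      (use False in \<open>auto intro!: derivative_eq_intros simp flip: has_real_derivative_iff_has_vector_derivative\<close>)
  moreover have "sin (of_int m * (2 * pi)) = 0"
    using sin_int_2pin[of m] by (simp add: mult.commute)
  ultimately show ?thesis using False by simp
qed

definition cos_sum :: "(int \<Rightarrow> real) \<Rightarrow> real \<Rightarrow> real" where
  "cos_sum \<alpha> t = (\<Sum>j | \<alpha> j \<noteq> 0. \<alpha> j * cos (of_int j * t))"

lemma cos_sum_superset:
  assumes "finite A" "{j. \<alpha> j \<noteq> 0} \<subseteq> A"
  shows "cos_sum \<alpha> t = (\<Sum>j\<in>A. \<alpha> j * cos (of_int j * t))"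
  unfolding cos_sum_def using assms by (intro sum.mono_neutral_left) auto

text \<open>The easy direction of Herglotz's theorem: \<open>2 * pi\<close> times the quadratic form
  is the integral over a period of \<open>cos_sum c t\<close> times the squared modulus of the
  exponential sum with weights \<open>g i\<close> and frequencies \<open>x i\<close>.\<close>

lemma pos_def_cos_sum:
  assumes fin: "finite {j. c j \<noteq> 0}" and even: "\<And>j. c (- j) = c j" and nonneg: "\<And>t. 0 \<le> cos_sum c t"
  shows "pos_def c"
  unfolding pos_def_def
proof (intro conjI allI even)
  fix n :: nat and g :: "nat \<Rightarrow> real" and x :: "nat \<Rightarrow> int"
  define A where "A = {j. c j \<noteq> 0}"
  \<comment> \<open>The integral of \<open>cos (l * t) * cos (d * t)\<close> over a period; both
    summands contribute when \<open>l = d = 0\<close>.\<close>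
  define I where "I = (\<lambda>d l::int. pi * (if l = d then 1 else 0) + pi * (if l = - d then 1 else 0))"
  define F where "F = (\<lambda>t. \<Sum>i<n. \<Sum>j<n. \<Sum>l\<in>A. g i * g j * c l * (cos (of_int l * t) * cos (of_int (x i - x j) * t)))"
  have int1: "((\<lambda>t. cos (of_int l * t) * cos (of_int d * t)) has_integral I d l) {0..2 * pi}" for l d
  proof -
    have "((\<lambda>t. (cos (of_int (l - d) * t) + cos (of_int (l + d) * t)) / 2) has_integral
        ((if l - d = 0 then 2 * pi else 0) + (if l + d = 0 then 2 * pi else 0)) / 2) {0..2 * pi}"
      by (intro has_integral_divide has_integral_add has_integral_cos_int)
    moreover have "((if l - d = 0 then 2 * pi else 0) + (if l + d = 0 then 2 * pi else 0)) / 2 = I d l"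
      by (auto simp: I_def)
    moreover have "(cos (of_int (l - d) * t) + cos (of_int (l + d) * t)) / 2 = cos (of_int l * t) * cos (of_int d * t)" for t :: real
      by (simp add: cos_times_cos left_diff_distrib distrib_right)
    ultimately show ?thesis by simp
  qed
  have F: "(F has_integral (\<Sum>i<n. \<Sum>j<n. \<Sum>l\<in>A. g i * g j * c l * I (x i - x j) l)) {0..2 * pi}"
    unfolding F_def using fin
    by (intro has_integral_sum has_integral_mult_right int1) (auto simp: A_def)
  have "F t = cos_sum c t * ((\<Sum>i<n. g i * cos (of_int (x i) * t))\<^sup>2 + (\<Sum>i<n. g i * sin (of_int (x i) * t))\<^sup>2)" for t
  proof -
    have "(\<Sum>l\<in>A. g i * g j * c l * (cos (of_int l * t) * cos (of_int (x i - x j) * t)))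
        = cos_sum c t * (g i * g j * cos (of_int (x i - x j) * t))" for i j
      unfolding cos_sum_def A_def sum_distrib_right by (intro sum.cong) auto
    then have "F t = (\<Sum>i<n. \<Sum>j<n. cos_sum c t * (g i * g j * cos (of_int (x i - x j) * t)))"
      by (simp add: F_def)
    also have "\<dots> = cos_sum c t * (\<Sum>i<n. \<Sum>j<n. (g i * cos (of_int (x i) * t)) * (g j * cos (of_int (x j) * t))
        + (g i * sin (of_int (x i) * t)) * (g j * sin (of_int (x j) * t)))"
      by (simp add: sum_distrib_left cos_diff left_diff_distrib algebra_simps)
    also have "\<dots> = cos_sum c t * ((\<Sum>i<n. g i * cos (of_int (x i) * t))\<^sup>2 + (\<Sum>i<n. g i * sin (of_int (x i) * t))\<^sup>2)"
      by (simp add: power2_eq_square sum_product sum.distrib)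
    finally show ?thesis .
  qed
  then have "0 \<le> F t" for t using nonneg by simp
  then have "0 \<le> (\<Sum>i<n. \<Sum>j<n. \<Sum>l\<in>A. g i * g j * c l * I (x i - x j) l)"
    using has_integral_nonneg[OF F] by simp
  also have "\<dots> = (\<Sum>i<n. \<Sum>j<n. 2 * pi * (g i * g j * c (x i - x j)))"
  proof (intro sum.cong refl)
    fix i j
    have *: "(\<Sum>l\<in>A. c l * (if l = d then 1 else 0)) = c d" for d
      using fin by (simp add: A_def if_distrib sum.delta' cong: if_cong)
    have "(\<Sum>l\<in>A. g i * g j * c l * I (x i - x j) l)
      = g i * g j * pi * ((\<Sum>l\<in>A. c l * (if l = x i - x j then 1 else 0)) + (\<Sum>l\<in>A. c l * (if l = - (x i - x j) then 1 else 0)))"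
      unfolding I_def sum.distrib[symmetric] sum_distrib_left by (intro sum.cong) (auto simp: algebra_simps)
    also have "\<dots> = 2 * pi * (g i * g j * c (x i - x j))"
      unfolding * even by simp
    finally show "(\<Sum>l\<in>A. g i * g j * c l * I (x i - x j) l) = 2 * pi * (g i * g j * c (x i - x j))" .
  qed
  also have "\<dots> = 2 * pi * (\<Sum>i<n. \<Sum>j<n. g i * g j * c (x i - x j))"
    by (simp add: sum_distrib_left)
  finally show "0 \<le> (\<Sum>i<n. \<Sum>j<n. g i * g j * c (x i - x j))"
    using pi_gt_zero by (simp add: zero_le_mult_iff not_le)
qed

text \<open>Multiplication of a cosine sum by \<open>2 (cos t - x)\<close>, on coefficient sequences.\<close>

definition mult_root :: "real \<Rightarrow> (int \<Rightarrow> real) \<Rightarrow> int \<Rightarrow> real" where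
  "mult_root x \<alpha> j = \<alpha> (j - 1) + \<alpha> (j + 1) - 2 * x * \<alpha> j"

definition mult_roots :: "real list \<Rightarrow> (int \<Rightarrow> real) \<Rightarrow> int \<Rightarrow> real" where
  "mult_roots xs \<alpha> = foldr mult_root xs \<alpha>"

lemma mult_roots_simps [simp]:
  "mult_roots [] \<alpha> = \<alpha>" "mult_roots (x # xs) \<alpha> = mult_root x (mult_roots xs \<alpha>)"
  by (simp_all add: mult_roots_def)

lemma finite_support_mult_root:
  assumes "finite {j. \<alpha> j \<noteq> 0}"
  shows "finite {j. mult_root x \<alpha> j \<noteq> 0}"
proof (rule finite_subset)
  let ?A = "{j. \<alpha> j \<noteq> 0}"
  show "{j. mult_root x \<alpha> j \<noteq> 0} \<subseteq> (\<lambda>j. j + 1) ` ?A \<union> (\<lambda>j. j - 1) ` ?A \<union> ?A"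
  proof
    fix j assume "j \<in> {j. mult_root x \<alpha> j \<noteq> 0}"
    then have "\<alpha> (j - 1) \<noteq> 0 \<or> \<alpha> (j + 1) \<noteq> 0 \<or> \<alpha> j \<noteq> 0" by (auto simp: mult_root_def)
    then show "j \<in> (\<lambda>j. j + 1) ` ?A \<union> (\<lambda>j. j - 1) ` ?A \<union> ?A"
      using image_eqI[of j "\<lambda>j. j + 1" "j - 1" ?A] image_eqI[of j "\<lambda>j. j - 1" "j + 1" ?A] by auto
  qed
qed (use assms in auto)

lemma cos_sum_mult_root:
  assumes fin: "finite {j. \<alpha> j \<noteq> 0}"
  shows "cos_sum (mult_root x \<alpha>) t = 2 * (cos t - x) * cos_sum \<alpha> t"
proof -
  define A where "A = {j. \<alpha> j \<noteq> 0}"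
  define B where "B = (\<lambda>j. j + 1) ` A \<union> (\<lambda>j. j - 1) ` A \<union> A \<union> {j. mult_root x \<alpha> j \<noteq> 0}"
  have fB: "finite B" using fin finite_support_mult_root[OF fin] by (simp add: B_def A_def)
  have sh: "(\<Sum>j\<in>B. \<alpha> (j - d) * cos (of_int j * t)) = (\<Sum>j\<in>A. \<alpha> j * cos (of_int (j + d) * t))"
    if "(\<lambda>j. j + d) ` A \<subseteq> B" for d
  proof -
    have "(\<Sum>j\<in>B. \<alpha> (j - d) * cos (of_int j * t)) = (\<Sum>j\<in>(\<lambda>j. j + d) ` A. \<alpha> (j - d) * cos (of_int j * t))"
    proof (rule sum.mono_neutral_right[OF fB that], rule ballI)
      fix j assume "j \<in> B - (\<lambda>j. j + d) ` A"
      then have "j - d \<notin> A" using image_eqI[of j "\<lambda>j. j + d" "j - d" A] by auto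
      then show "\<alpha> (j - d) * cos (of_int j * t) = 0" by (simp add: A_def)
    qed
    also have "\<dots> = (\<Sum>j\<in>A. \<alpha> j * cos (of_int (j + d) * t))"
      by (subst sum.reindex) (auto simp: inj_on_def)
    finally show ?thesis .
  qed
  have "cos_sum (mult_root x \<alpha>) t = (\<Sum>j\<in>B. mult_root x \<alpha> j * cos (of_int j * t))"
    by (rule cos_sum_superset[OF fB]) (auto simp: B_def)
  also have "\<dots> = (\<Sum>j\<in>B. \<alpha> (j - 1) * cos (of_int j * t)) + (\<Sum>j\<in>B. \<alpha> (j - (-1)) * cos (of_int j * t))
      - 2 * x * (\<Sum>j\<in>B. \<alpha> (j - 0) * cos (of_int j * t))"
    by (simp add: mult_root_def algebra_simps sum.distrib sum_subtractf sum_distrib_left)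
  also have "\<dots> = (\<Sum>j\<in>A. \<alpha> j * cos (of_int (j + 1) * t)) + (\<Sum>j\<in>A. \<alpha> j * cos (of_int (j + (-1)) * t))
      - 2 * x * (\<Sum>j\<in>A. \<alpha> j * cos (of_int (j + 0) * t))"
    by (subst (1 2 3) sh) (auto simp: B_def)
  also have "\<dots> = (\<Sum>j\<in>A. \<alpha> j * (cos (of_int (j + 1) * t) + cos (of_int (j + (-1)) * t) - 2 * x * cos (of_int j * t)))"
    by (simp add: algebra_simps sum.distrib sum_subtractf sum_distrib_left)
  also have "\<dots> = (\<Sum>j\<in>A. 2 * (cos t - x) * (\<alpha> j * cos (of_int j * t)))"
    by (intro sum.cong refl) (simp add: ring_distribs cos_add cos_diff)
  also have "\<dots> = 2 * (cos t - x) * cos_sum \<alpha> t"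
    by (simp add: cos_sum_def A_def sum_distrib_left)
  finally show ?thesis .
qed

lemma finite_support_mult_roots:
  "finite {j. \<alpha> j \<noteq> 0} \<Longrightarrow> finite {j. mult_roots xs \<alpha> j \<noteq> 0}"
  by (induction xs) (auto intro: finite_support_mult_root)

lemma cos_sum_mult_roots:
  "finite {j. \<alpha> j \<noteq> 0} \<Longrightarrow>
    cos_sum (mult_roots xs \<alpha>) t = 2 ^ length xs * (\<Prod>x\<leftarrow>xs. cos t - x) * cos_sum \<alpha> t"
  by (induction xs) (auto simp: cos_sum_mult_root finite_support_mult_roots)

lemma mult_roots_even:
  "(\<And>j. \<alpha> (- j) = \<alpha> j) \<Longrightarrow> mult_roots xs \<alpha> (- j) = mult_roots xs \<alpha> j"
proof (induction xs arbitrary: j)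
  case (Cons x xs)
  show ?case
    using Cons.IH[OF Cons.prems, of "j + 1"] Cons.IH[OF Cons.prems, of "j - 1"] Cons.IH[OF Cons.prems, of j]
    by (simp add: mult_root_def)
qed simp

text \<open>Applying \<open>mult_root x\<close> to the kernel of \<open>xs\<close> gives the kernel
  of \<open>x # xs\<close>, and each factor enlarges it at most by
  \<open>1 + 1 + 2 * \<bar>x\<bar> \<le> 4\<close>. The last entry 1 allows the recurrence to be
  solved for the newest term.\<close>

lemma mult_roots_convolution:
  assumes "\<And>x. x \<in> set xs \<Longrightarrow> \<bar>x\<bar> \<le> 1"
  shows "\<exists>q. (\<forall>i. length xs < \<bar>i\<bar> \<longrightarrow> q i = 0) \<and> q (length xs) = 1 \<and> (\<forall>i. \<bar>q i\<bar> \<le> 4 ^ length xs) \<and>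
    (\<forall>\<alpha> j. mult_roots xs \<alpha> j = (\<Sum>i = - int (length xs)..int (length xs). q i * \<alpha> (j + i)))"
  using assms
proof (induction xs)
  case Nil
  show ?case by (rule exI[of _ "\<lambda>i. if i = 0 then 1 else 0"]) simp
next
  case (Cons x xs)
  let ?m = "int (length xs)"
  obtain q where q: "\<And>i. ?m < \<bar>i\<bar> \<Longrightarrow> q i = 0" "q ?m = 1" "\<And>i. \<bar>q i\<bar> \<le> 4 ^ length xs"
    and conv: "\<And>\<alpha> j. mult_roots xs \<alpha> j = (\<Sum>i = - ?m..?m. q i * \<alpha> (j + i))"
    using Cons by auto
  have x: "\<bar>x\<bar> \<le> 1" using Cons.prems by simp
  have bound: "\<bar>mult_root x q i\<bar> \<le> 4 ^ length (x # xs)" for i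
  proof -
    have "\<bar>2 * x * q i\<bar> \<le> 2 * 4 ^ length xs"
      using mult_mono[OF x q(3)[of i]] by (simp add: abs_mult)
    then show ?thesis
      using q(3)[of "i - 1"] q(3)[of "i + 1"] by (simp add: mult_root_def)
  qed
  have sh: "(\<Sum>i = - ?m..?m. q i * \<alpha> (j + d + i)) = (\<Sum>i = - ?m - 1..?m + 1. q (i - d) * \<alpha> (j + i))"
    if "\<bar>d\<bar> \<le> 1" for \<alpha> j d
  proof -
    have "(\<Sum>i = - ?m..?m. q i * \<alpha> (j + d + i)) = (\<Sum>i\<in>(\<lambda>i. i + d) ` {- ?m..?m}. q (i - d) * \<alpha> (j + i))"
      by (subst sum.reindex) (auto simp: inj_on_def algebra_simps)
    also have "\<dots> = (\<Sum>i = - ?m - 1..?m + 1. q (i - d) * \<alpha> (j + i))"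
      by (rule sum.mono_neutral_left) (use that q(1) in auto)
    finally show ?thesis .
  qed
  have "mult_roots (x # xs) \<alpha> j = (\<Sum>i = - ?m - 1..?m + 1. mult_root x q i * \<alpha> (j + i))" for \<alpha> j
  proof -
    have "mult_roots (x # xs) \<alpha> j = (\<Sum>i = - ?m..?m. q i * \<alpha> (j + (-1) + i))
       + (\<Sum>i = - ?m..?m. q i * \<alpha> (j + 1 + i)) - 2 * x * (\<Sum>i = - ?m..?m. q i * \<alpha> (j + 0 + i))"
      by (simp add: mult_root_def conv)
    also have "\<dots> = (\<Sum>i = - ?m - 1..?m + 1. mult_root x q i * \<alpha> (j + i))"
      by (subst (1 2 3) sh)
        (auto simp: mult_root_def algebra_simps sum.distrib sum_subtractf sum_distrib_left)
    finally show ?thesis .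
  qed
  moreover have "- ?m - 1 = - int (length (x # xs))" "?m + 1 = int (length (x # xs))" by auto
  moreover have "mult_root x q i = 0" if "int (length (x # xs)) < \<bar>i\<bar>" for i
    using q(1)[of i] q(1)[of "i - 1"] q(1)[of "i + 1"] that by (auto simp: mult_root_def)
  moreover have "mult_root x q (int (length (x # xs))) = 1"
    using q(1)[of "?m + 1"] q(1)[of "?m + 2"] q(2) by (simp add: mult_root_def add.commute)
  ultimately show ?case
    using bound by (intro exI[of _ "mult_root x q"]) (metis (no_types))
qed

section \<open>Chebyshev polynomials and correction of signs\<close>

lemma cos_multiple_poly: "\<exists>p. \<forall>t::real. cos (of_nat n * t) = poly p (cos t)"
proof (induction n rule: less_induct)
  case (less n)
  consider "n = 0" | "n = 1" | k where "n = k + 2"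
    by (metis One_nat_def Suc_1 add_Suc_right add_cancel_right_right not0_implies_Suc)
  then show ?case
  proof cases
    case 1 then show ?thesis by (intro exI[of _ 1]) simp
  next
    case 2 then show ?thesis by (intro exI[of _ "[:0, 1:]"]) simp
  next
    case 3
    obtain p q where p: "\<And>t::real. cos (of_nat k * t) = poly p (cos t)" and q: "\<And>t::real. cos (of_nat (k + 1) * t) = poly q (cos t)"
      using less[of k] less[of "k + 1"] 3 by auto
    have "cos (of_nat n * t) = poly ([:0, 2:] * q - p) (cos t)" for t :: real
    proof -
      have "cos (of_nat n * t) + cos (of_nat k * t) = 2 * cos t * cos (of_nat (k + 1) * t)"
        using cos_times_cos[of "of_nat (k + 1) * t" t] 3 by (simp add: algebra_simps)
      then show ?thesis unfolding p q by simp
    qed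
    then show ?thesis by blast
  qed
qed

lemma cos_sum_poly: "\<exists>p. \<forall>t. cos_sum \<alpha> t = poly p (cos t)"
proof -
  have "\<exists>p. \<forall>t::real. cos (of_int j * t) = poly p (cos t)" for j :: int
  proof (cases "0 \<le> j")
    case True
    then show ?thesis using cos_multiple_poly[of "nat j"] by simp
  next
    case False
    then have "cos (of_int j * t) = cos (of_nat (nat (- j)) * t)" for t :: real
      using cos_minus[of "of_int j * t"] by simp
    then show ?thesis using cos_multiple_poly[of "nat (- j)"] by simp
  qed
  then obtain p where p: "\<And>j (t::real). cos (of_int j * t) = poly (p j) (cos t)" by metis
  have "cos_sum \<alpha> t = poly (\<Sum>j | \<alpha> j \<noteq> 0. smult (\<alpha> j) (p j)) (cos t)" for t
    by (simp add: cos_sum_def p poly_sum)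
  then show ?thesis by blast
qed

lemma poly_constant_sign:
  fixes U :: "real poly"
  assumes "\<And>x. a < x \<Longrightarrow> x < b \<Longrightarrow> poly U x \<noteq> 0"
  shows "(\<forall>y\<in>{a..b}. 0 \<le> poly U y) \<or> (\<forall>y\<in>{a..b}. poly U y \<le> 0)"
proof (rule ccontr)
  assume "\<not> ?thesis"
  then obtain u v where uv: "u \<in> {a..b}" "v \<in> {a..b}" "poly U u < 0" "0 < poly U v"
    by (auto simp: not_le)
  have "u \<noteq> v" using uv by auto
  then show False
    using poly_IVT_pos[of u v U] poly_IVT_neg[of v u U] uv assms by (cases "u < v") fastforce+
qed

text \<open>The list consists of the zeros of odd multiplicity. Splitting off a linear factor at
  \<open>x\<close> flips the parity at \<open>x\<close>, so \<open>x\<close> is removed if present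
  and added otherwise; multiplicities need not be mentioned.\<close>

lemma poly_fix_sign:
  fixes U :: "real poly"
  assumes "U \<noteq> 0"
  shows "\<exists>xs s. distinct xs \<and> set xs \<subseteq> {x. a < x \<and> x < b \<and> poly U x = 0} \<and> (s = 1 \<or> s = - 1) \<and>
    (\<forall>y\<in>{a..b}. 0 \<le> s * (poly U y * (\<Prod>x\<leftarrow>xs. y - x)))"
  using assms
proof (induction "degree U" arbitrary: U rule: less_induct)
  case (less U)
  show ?case
  proof (cases "\<exists>x. a < x \<and> x < b \<and> poly U x = 0")
    case False
    then consider "\<forall>y\<in>{a..b}. 0 \<le> poly U y" | "\<forall>y\<in>{a..b}. poly U y \<le> 0"
      using poly_constant_sign by blast
    then show ?thesis
    proof cases
      case 1 then show ?thesis by (intro exI[of _ "[]"] exI[of _ 1]) simp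
    next
      case 2 then show ?thesis by (intro exI[of _ "[]"] exI[of _ "- 1"]) simp
    qed
  next
    case True
    then obtain x where x: "a < x" "x < b" "poly U x = 0" by blast
    then obtain V where V: "U = [:- x, 1:] * V" using poly_eq_0_iff_dvd by (metis dvdE)
    then have "V \<noteq> 0" using less.prems by auto
    then have "degree V < degree U" by (simp add: V degree_mult_eq del: mult_pCons_left)
    then obtain xs s where IH: "distinct xs" "set xs \<subseteq> {x. a < x \<and> x < b \<and> poly V x = 0}" "s = 1 \<or> s = - 1"
      "\<And>y. y \<in> {a..b} \<Longrightarrow> 0 \<le> s * (poly V y * (\<Prod>x\<leftarrow>xs. y - x))"
      using less.hyps[of V] \<open>V \<noteq> 0\<close> by blast
    have U: "poly U y = (y - x) * poly V y" for y by (simp add: V algebra_simps)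
    show ?thesis
    proof (cases "x \<in> set xs")
      case True
      have "(\<Prod>x\<leftarrow>xs. y - x) = (y - x) * (\<Prod>x\<leftarrow>remove1 x xs. y - x)" for y
        using True IH(1) prod.remove[of "set xs" x "\<lambda>x. y - x"]
        by (simp add: prod.distinct_set_conv_list[symmetric])
      then have "poly U y * (\<Prod>x\<leftarrow>remove1 x xs. y - x) = poly V y * (\<Prod>x\<leftarrow>xs. y - x)" for y
        by (simp add: U)
      moreover have "set (remove1 x xs) \<subseteq> {x. a < x \<and> x < b \<and> poly U x = 0}"
        using IH(2) set_remove1_subset[of x xs] by (auto simp: U)
      ultimately show ?thesis
        using IH by (intro exI[of _ "remove1 x xs"] exI[of _ s]) auto
    next
      case False
      have "0 \<le> s * (poly U y * (\<Prod>x\<leftarrow>x # xs. y - x))" if "y \<in> {a..b}" for y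
      proof -
        have "s * (poly U y * (\<Prod>x\<leftarrow>x # xs. y - x)) = (y - x)\<^sup>2 * (s * (poly V y * (\<Prod>x\<leftarrow>xs. y - x)))"
          by (simp add: U power2_eq_square algebra_simps)
        then show ?thesis using IH(4)[OF that] by (metis mult_nonneg_nonneg zero_le_power2)
      qed
      moreover have "set (x # xs) \<subseteq> {x. a < x \<and> x < b \<and> poly U x = 0}"
        using IH(2) x by (auto simp: U)
      ultimately show ?thesis
        using IH(1,3) False by (intro exI[of _ "x # xs"] exI[of _ s]) auto
    qed
  qed
qed

lemma cos_sum_cmult: "cos_sum (\<lambda>j. s * \<alpha> j) t = s * cos_sum \<alpha> t"
  by (cases "s = 0") (simp_all add: cos_sum_def sum_distrib_left algebra_simps)

text \<open>The substitution \<open>x = cos t\<close> matches \<open>0 < t < pi\<close> with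
  \<open>- 1 < x < 1\<close>, so at most \<open>M\<close> factors occur, and a constant sign on the
  closed interval from -1 to 1 is a constant sign for all real \<open>t\<close>.\<close>

lemma mult_roots_pos_def:
  assumes fin: "finite {j. \<alpha> j \<noteq> 0}" and even: "\<And>j. \<alpha> (- j) = \<alpha> j"
    and Z: "finite {t. 0 < t \<and> t < pi \<and> cos_sum \<alpha> t = 0}" "card {t. 0 < t \<and> t < pi \<and> cos_sum \<alpha> t = 0} \<le> M"
  shows "\<exists>xs s. length xs \<le> M \<and> (\<forall>x\<in>set xs. \<bar>x\<bar> \<le> 1) \<and> (s = 1 \<or> s = - 1) \<and>
    pos_def (\<lambda>j. s * mult_roots xs \<alpha> j)"
proof -
  obtain U where U: "\<And>t. cos_sum \<alpha> t = poly U (cos t)" using cos_sum_poly by metis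
  have "U \<noteq> 0"
  proof
    assume "U = 0"
    then have "{t. 0 < t \<and> t < pi \<and> cos_sum \<alpha> t = 0} = {0<..<pi}" by (auto simp: U)
    then show False using Z(1) infinite_Ioo[OF pi_gt_zero] by simp
  qed
  then obtain xs s where xs: "distinct xs" "set xs \<subseteq> {x. - 1 < x \<and> x < 1 \<and> poly U x = 0}" and s: "s = 1 \<or> s = - 1"
    and sign: "\<And>y. y \<in> {- 1..1} \<Longrightarrow> 0 \<le> s * (poly U y * (\<Prod>x\<leftarrow>xs. y - x))"
    using poly_fix_sign[of U "- 1" 1] by blast
  have "card (arccos ` set xs) \<le> card {t. 0 < t \<and> t < pi \<and> cos_sum \<alpha> t = 0}"
  proof (rule card_mono[OF Z(1)], rule image_subsetI)
    fix x assume "x \<in> set xs"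
    then have "- 1 < x" "x < 1" "poly U x = 0" using xs(2) by auto
    then show "arccos x \<in> {t. 0 < t \<and> t < pi \<and> cos_sum \<alpha> t = 0}"
      using arccos_lt_bounded[of x] by (simp add: U)
  qed
  moreover have "card (arccos ` set xs) = length xs"
  proof -
    have "inj_on arccos (set xs)"
      by (rule inj_on_inverseI[of _ cos]) (use xs(2) in auto)
    then show ?thesis using xs(1) by (simp add: card_image distinct_card)
  qed
  ultimately have "length xs \<le> M" using Z(2) by simp
  moreover have "pos_def (\<lambda>j. s * mult_roots xs \<alpha> j)"
  proof (rule pos_def_cos_sum)
    show "finite {j. s * mult_roots xs \<alpha> j \<noteq> 0}"
      by (rule finite_subset[OF _ finite_support_mult_roots[OF fin, of xs]]) auto
    show "s * mult_roots xs \<alpha> (- j) = s * mult_roots xs \<alpha> j" for j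
      using mult_roots_even[of \<alpha> xs j] even by simp
    fix t
    have "cos_sum (\<lambda>j. s * mult_roots xs \<alpha> j) t = 2 ^ length xs * (s * (poly U (cos t) * (\<Prod>x\<leftarrow>xs. cos t - x)))"
      by (simp add: cos_sum_cmult cos_sum_mult_roots[OF fin] U)
    then show "0 \<le> cos_sum (\<lambda>j. s * mult_roots xs \<alpha> j) t"
      using sign[of "cos t"] by simp
  qed
  ultimately show ?thesis using s xs(2) by (intro exI[of _ xs] exI[of _ s]) force
qed

section \<open>Almost periodicity of the coefficients\<close>

lemma finite_set_separation:
  fixes S :: "real set"
  assumes "finite S"
  shows "\<exists>\<delta>>0. \<forall>u\<in>S. \<forall>v\<in>S. \<bar>u - v\<bar> < \<delta> \<longrightarrow> u = v"
proof -
  define D where "D = insert 1 ((\<lambda>(u, v). \<bar>u - v\<bar>) ` (S \<times> S) - {0})"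
  have D: "finite D" "D \<noteq> {}" "\<And>d. d \<in> D \<Longrightarrow> 0 < d" using assms by (auto simp: D_def)
  show ?thesis
  proof (intro exI[of _ "Min D"] conjI ballI impI)
    show "0 < Min D" using D by simp
    fix u v assume uv: "u \<in> S" "v \<in> S" "\<bar>u - v\<bar> < Min D"
    show "u = v"
    proof (rule ccontr)
      assume "u \<noteq> v"
      then have "\<bar>u - v\<bar> \<in> D" using uv by (force simp: D_def)
      then show False using Min_le[OF D(1)] uv(3) by force
    qed
  qed
qed

text \<open>Where the recurrence \<open>q\<close> holds up to an error below half the separation of \<open>S\<close>, each value is
  determined by the preceding ones, so the sequence is periodic by the pigeonhole principle.\<close>

lemma periodic_of_determined:
  fixes \<alpha> :: "int \<Rightarrow> 'a"
  assumes S: "finite S" "\<And>j. \<alpha> j \<in> S" and r: "card S ^ (2 * m) \<le> r"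
    and det: "\<And>j j'. j \<in> {t - int r - 2 * int m..t + int (fact r) + 2 * int m} \<Longrightarrow>
        j' \<in> {t - int r - 2 * int m..t + int (fact r) + 2 * int m} \<Longrightarrow>
        (\<forall>i\<in>{- int m..<int m}. \<alpha> (j + i) = \<alpha> (j' + i)) \<Longrightarrow> \<alpha> (j + int m) = \<alpha> (j' + int m)"
  shows "\<alpha> (t + int (fact r)) = \<alpha> t"
proof -
  \<comment> \<open>The \<open>r + 1\<close> windows of length \<open>2 * m\<close> around
    \<open>p 0\<close> to \<open>p r\<close> all end before \<open>t\<close>. There are at most
    \<open>r\<close> possible contents, so two windows agree.\<close>
  define p where "p = (\<lambda>u. t - int r - int m + int u)"
  define st where "st = (\<lambda>u. restrict (\<lambda>i. \<alpha> (p u + i)) {- int m..<int m})"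
  define E where "E = PiE {- int m..<int m} (\<lambda>_. S)"
  have "card E = card S ^ (2 * m)" by (simp add: E_def card_PiE nat_mult_distrib)
  moreover have "finite E" by (simp add: E_def finite_PiE S)
  moreover have "st ` {..r} \<subseteq> E" using S(2) by (auto simp: st_def E_def)
  ultimately have "card (st ` {..r}) < card {..r}"
    using card_mono[of E "st ` {..r}"] r by simp
  then have "\<not> inj_on st {..r}" using pigeonhole by blast
  then obtain u v where uv: "u < v" "v \<le> r" "st u = st v"
    unfolding inj_on_def by (metis atMost_iff linorder_neqE_nat order.strict_implies_order order_trans)
  define h where "h = v - u"
  have h: "0 < h" "h \<le> r" "p v = p u + int h" using uv by (auto simp: h_def p_def)
  have init: "\<alpha> (p u + i) = \<alpha> (p v + i)" if "i \<in> {- int m..<int m}" for i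
    using fun_cong[OF uv(3), of i] that by (simp add: st_def)
  have per: "\<alpha> (p u - int m + int i) = \<alpha> (p v - int m + int i)"
    if "p v - int m + int i \<le> t + int (fact r)" for i
    using that
  proof (induction i rule: less_induct)
    case (less i)
    show ?case
    proof (cases "i < 2 * m")
      case True
      then show ?thesis using init[of "int i - int m"] by (simp add: algebra_simps)
    next
      case False
      define k where "k = int i - 2 * int m"
      have k: "0 \<le> k" using False by (simp add: k_def)
      have "\<alpha> (p u + k + int m) = \<alpha> (p v + k + int m)"
      proof (rule det)
        show "p u + k \<in> {t - int r - 2 * int m..t + int (fact r) + 2 * int m}"
          "p v + k \<in> {t - int r - 2 * int m..t + int (fact r) + 2 * int m}"
          using k less.prems uv by (auto simp: p_def k_def)
        show "\<forall>i\<in>{- int m..<int m}. \<alpha> (p u + k + i) = \<alpha> (p v + k + i)"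
        proof
          fix l assume l: "l \<in> {- int m..<int m}"
          define i' where "i' = nat (k + l + int m)"
          have i': "int i' = k + l + int m" using k l by (simp add: i'_def)
          then have "i' < i" using l by (simp add: k_def)
          moreover have "p v - int m + int i' \<le> t + int (fact r)"
            using less.prems \<open>i' < i\<close> by simp
          ultimately show "\<alpha> (p u + k + l) = \<alpha> (p v + k + l)"
            using less.IH[of i'] by (simp add: i' algebra_simps)
        qed
      qed
      then show ?thesis by (simp add: k_def algebra_simps)
    qed
  qed
  have step: "\<alpha> z = \<alpha> (z + int h)" if "t \<le> z" "z + int h \<le> t + int (fact r)" for z
  proof -
    define i where "i = nat (z - p u + int m)"
    have "p u \<le> t" using uv by (simp add: p_def)
    then have "int i = z - p u + int m" using that by (simp add: i_def)
    then show ?thesis using per[of i] that by (simp add: h algebra_simps)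
  qed
  \<comment> \<open>The period \<open>h\<close> varies with the sequence; the factorial is a common
    multiple of all candidates up to \<open>r\<close>.\<close>
  have "h dvd fact r" using h by (simp add: dvd_fact)
  then obtain w where w: "fact r = h * w" by (metis dvdE)
  have "\<alpha> t = \<alpha> (t + int (h * i))" if "i \<le> w" for i
    using that
  proof (induction i)
    case (Suc i)
    have "int (h * i) + int h \<le> int (h * w)"
      using Suc.prems by (metis Suc_leD mult_Suc_right mult_le_mono2 of_nat_add of_nat_mono add.commute)
    then have "\<alpha> (t + int (h * i)) = \<alpha> (t + int (h * i) + int h)"
      by (intro step) (auto simp: w)
    then show ?case using Suc by (simp add: algebra_simps)
  qed simp
  from this[of w] show ?thesis by (simp add: w)
qed

text \<open>\<open>pos_def_few_large_values\<close> applies to the convolved sequence because each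
  of its values is determined by \<open>2 * m + 1\<close> entries of \<open>\<alpha>\<close>, with a
  fixed kernel; this bounds the number of values through \<open>card S\<close> and \<open>M\<close>
  alone.\<close>

lemma few_zeros_almost_periodic:
  fixes S :: "real set"
  assumes S: "finite S" "0 \<in> S"
  shows "\<exists>K\<ge>1. \<exists>N. \<forall>\<alpha>. (\<forall>j. \<alpha> j \<in> S) \<longrightarrow> (\<forall>j. \<alpha> (- j) = \<alpha> j) \<longrightarrow> finite {j. \<alpha> j \<noteq> 0} \<longrightarrow>
    finite {t. 0 < t \<and> t < pi \<and> cos_sum \<alpha> t = 0} \<longrightarrow>
    card {t. 0 < t \<and> t < pi \<and> cos_sum \<alpha> t = 0} \<le> M \<longrightarrow>
    card {j. \<alpha> (j + int K) \<noteq> \<alpha> j} \<le> N"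
proof -
  define r where "r = card S ^ (2 * M)"
  define K :: nat where "K = fact r"
  have cS: "1 \<le> card S" using S by (auto simp: Suc_le_eq card_gt_0_iff)
  obtain \<delta> where \<delta>: "0 < \<delta>" "\<And>u v. u \<in> S \<Longrightarrow> v \<in> S \<Longrightarrow> \<bar>u - v\<bar> < \<delta> \<Longrightarrow> u = v"
    using finite_set_separation[OF S(1)] by blast
  obtain B where B: "\<And>v. v \<in> S \<Longrightarrow> \<bar>v\<bar> \<le> B"
    using S(1) finite_imp_bounded[THEN bounded_iff[THEN iffD1]] by (metis real_norm_def)
  have B0: "0 \<le> B" using B[OF S(2)] by simp
  define C where "C = real (2 * M + 1) * 4 ^ M * B"
  \<comment> \<open>Two values below \<open>\<delta> / 2\<close> in modulus differ by less than
    \<open>\<delta>\<close>. After equal preceding terms the newest terms then differ by less than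
    \<open>\<delta>\<close> too, hence agree.\<close>
  obtain N1 where N1: "\<And>c. pos_def c \<Longrightarrow> finite {j. c j \<noteq> 0} \<Longrightarrow> c 0 \<le> C \<Longrightarrow> card (range c) \<le> card S ^ (2 * M + 1) \<Longrightarrow>
    card {j. \<delta> / 2 \<le> \<bar>c j\<bar>} \<le> N1"
    using pos_def_few_large_values[of "\<delta> / 2" C "card S ^ (2 * M + 1)"] \<delta>(1) by auto
  show ?thesis
  proof (rule exI[of _ K], rule conjI[OF _ exI[of _ "N1 * (r + K + 4 * M + 1)"]], goal_cases)
    case 1
    show ?case by (simp add: K_def)
  next
    case 2
    show ?case
    proof (intro allI impI)
    fix \<alpha> :: "int \<Rightarrow> real"
    assume \<alpha>: "\<forall>j. \<alpha> j \<in> S" "\<forall>j. \<alpha> (- j) = \<alpha> j" "finite {j. \<alpha> j \<noteq> 0}"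
      and Z: "finite {t. 0 < t \<and> t < pi \<and> cos_sum \<alpha> t = 0}"
        "card {t. 0 < t \<and> t < pi \<and> cos_sum \<alpha> t = 0} \<le> M"
    obtain xs s where xs: "length xs \<le> M" "\<And>x. x \<in> set xs \<Longrightarrow> \<bar>x\<bar> \<le> 1" and s: "s = 1 \<or> s = - 1"
      and pd: "pos_def (\<lambda>j. s * mult_roots xs \<alpha> j)"
      using mult_roots_pos_def[OF \<alpha>(3) _ Z] \<alpha>(2) by blast
    define m where "m = length xs"
    define c where "c = (\<lambda>j. s * mult_roots xs \<alpha> j)"
    obtain q where q: "q (int m) = 1" "\<And>i. \<bar>q i\<bar> \<le> 4 ^ m"
      and conv: "\<And>j. mult_roots xs \<alpha> j = (\<Sum>i = - int m..int m. q i * \<alpha> (j + i))"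
      using mult_roots_convolution[of xs] xs(2) unfolding m_def by blast
    have m: "m \<le> M" using xs by (simp add: m_def)
    have finc: "finite {j. c j \<noteq> 0}"
      by (rule finite_subset[OF _ finite_support_mult_roots[OF \<alpha>(3), of xs]]) (auto simp: c_def)
    have c0: "c 0 \<le> C"
    proof -
      have "c 0 \<le> \<bar>\<Sum>i = - int m..int m. q i * \<alpha> (0 + i)\<bar>"
        using s by (auto simp: c_def conv)
      also have "\<dots> \<le> (\<Sum>i = - int m..int m. 4 ^ m * B)"
        by (rule order_trans[OF sum_abs], rule sum_mono)
          (use q(2) B \<alpha>(1) in \<open>auto simp: abs_mult intro!: mult_mono\<close>)
      also have "\<dots> = real (2 * m + 1) * (4 ^ m * B)"
        by (simp add: nat_add_distrib)
      also have "\<dots> \<le> real (2 * M + 1) * (4 ^ M * B)"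
        using m B0 by (intro mult_mono) (auto intro!: power_increasing)
      finally show ?thesis by (simp add: C_def)
    qed
    have rc: "card (range c) \<le> card S ^ (2 * M + 1)"
    proof -
      let ?E = "PiE {- int m..int m} (\<lambda>_. S)"
      have "range c \<subseteq> (\<lambda>g. s * (\<Sum>i = - int m..int m. q i * g i)) ` ?E"
      proof (rule image_subsetI)
        fix j :: int
        show "c j \<in> (\<lambda>g. s * (\<Sum>i = - int m..int m. q i * g i)) ` ?E"
          by (rule image_eqI[of _ _ "restrict (\<lambda>i. \<alpha> (j + i)) {- int m..int m}"])
            (use \<alpha>(1) in \<open>auto simp: c_def conv\<close>)
      qed
      then have "card (range c) \<le> card ?E"
        using S(1) by (intro surj_card_le) (auto intro!: finite_PiE)
      also have "\<dots> = card S ^ (2 * m + 1)"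
        by (simp add: card_PiE nat_add_distrib nat_mult_distrib)
      also have "\<dots> \<le> card S ^ (2 * M + 1)"
        using cS m by (intro power_increasing) auto
      finally show ?thesis .
    qed
    define Bad where "Bad = {j. \<delta> / 2 \<le> \<bar>c j\<bar>}"
    have Bad: "card Bad \<le> N1"
      unfolding Bad_def using N1 pd finc c0 rc unfolding c_def by blast
    have "Bad \<subseteq> {j. c j \<noteq> 0}" using \<delta>(1) by (auto simp: Bad_def)
    then have fB: "finite Bad" using finc finite_subset by blast
    have r: "card S ^ (2 * m) \<le> r"
      unfolding r_def using cS m by (intro power_increasing) auto
    \<comment> \<open>The recurrence is consulted from \<open>r + 2 * m\<close> places before
      \<open>t\<close> to \<open>K + 2 * m\<close> places after it, so each bad position spoils
      boundedly many \<open>t\<close>.\<close>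
    have "{t. \<alpha> (t + int K) \<noteq> \<alpha> t} \<subseteq> (\<Union>b\<in>Bad. {b - int K - 2 * int M..b + int r + 2 * int M})"
    proof
      fix t assume t: "t \<in> {t. \<alpha> (t + int K) \<noteq> \<alpha> t}"
      show "t \<in> (\<Union>b\<in>Bad. {b - int K - 2 * int M..b + int r + 2 * int M})"
      proof (rule ccontr)
        assume nt: "\<not> ?thesis"
        have "\<alpha> (t + int (fact r)) = \<alpha> t"
        proof (rule periodic_of_determined[OF S(1) _ r])
          show "\<alpha> j \<in> S" for j using \<alpha>(1) by blast
          fix j j' assume j: "j \<in> {t - int r - 2 * int m..t + int (fact r) + 2 * int m}"
            and j': "j' \<in> {t - int r - 2 * int m..t + int (fact r) + 2 * int m}"
            and eq: "\<forall>i\<in>{- int m..<int m}. \<alpha> (j + i) = \<alpha> (j' + i)"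
          have "j \<notin> Bad" "j' \<notin> Bad" using nt j j' m by (auto simp: K_def)
          then have "\<bar>c j - c j'\<bar> < \<delta>" by (auto simp: Bad_def)
          moreover have "{- int m..int m} = insert (int m) {- int m..<int m}" by auto
          then have "c j - c j' = s * (\<alpha> (j + int m) - \<alpha> (j' + int m))"
            using eq by (simp add: c_def conv q(1) algebra_simps)
          ultimately have "\<bar>\<alpha> (j + int m) - \<alpha> (j' + int m)\<bar> < \<delta>"
            using s by (auto simp: abs_minus_commute)
          then show "\<alpha> (j + int m) = \<alpha> (j' + int m)"
            using \<delta>(2) \<alpha>(1) by blast
        qed
        then show False using t by (simp add: K_def)
      qed
    qed
    then have "card {t. \<alpha> (t + int K) \<noteq> \<alpha> t} \<le> card (\<Union>b\<in>Bad. {b - int K - 2 * int M..b + int r + 2 * int M})"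
      using fB by (intro card_mono) auto
    also have "\<dots> \<le> (\<Sum>b\<in>Bad. card {b - int K - 2 * int M..b + int r + 2 * int M})"
      by (rule card_UN_le[OF fB])
    also have "\<dots> = card Bad * (r + K + 4 * M + 1)"
      by (simp add: nat_add_distrib nat_mult_distrib)
    also have "\<dots> \<le> N1 * (r + K + 4 * M + 1)"
      using Bad by (rule mult_le_mono1)
    finally show "card {j. \<alpha> (j + int K) \<noteq> \<alpha> j} \<le> N1 * (r + K + 4 * M + 1)" .
    qed
  qed
qed

section \<open>Cosine sums with few frequencies\<close>

text \<open>Clump sums will lie in such a set \<open>T\<close>; its separation turns a sufficiently
  small clump sum into an exact 0.\<close>

lemma finite_bounded_sums:
  fixes D :: "real set"
  assumes "finite D"
  shows "\<exists>T. finite T \<and> 0 \<in> T \<and> (\<forall>A f. finite (A::int set) \<longrightarrow> card A \<le> n \<longrightarrow> f ` A \<subseteq> D \<longrightarrow> sum f A \<in> T)"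
proof (induction n)
  case 0
  show ?case by (rule exI[of _ "{0}"]) auto
next
  case (Suc n)
  then obtain T where T: "finite T" "0 \<in> T"
    "\<And>A f. finite (A::int set) \<Longrightarrow> card A \<le> n \<Longrightarrow> f ` A \<subseteq> D \<Longrightarrow> sum f A \<in> T"
    by metis
  show ?case
  proof (intro exI[of _ "T \<union> (\<lambda>(u, v). u + v) ` (D \<times> T)"] conjI allI impI)
    fix A :: "int set" and f assume A: "finite A" "card A \<le> Suc n" "f ` A \<subseteq> D"
    show "sum f A \<in> T \<union> (\<lambda>(u, v). u + v) ` (D \<times> T)"
    proof (cases "A = {}")
      case False
      then obtain a where a: "a \<in> A" by blast
      have "sum f (A - {a}) \<in> T" using A a by (intro T(3)) auto
      moreover have "sum f A = f a + sum f (A - {a})" using A a by (simp add: sum.remove)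
      ultimately show ?thesis using A a by force
    qed (use T in simp)
  qed (use T assms in auto)
qed

section \<open>Integrals over short intervals\<close>

lemma sin_integral_near:
  fixes s l e w R :: real
  assumes "0 \<le> s" "0 \<le> l" "s + l \<le> e" "\<bar>w\<bar> \<le> R"
  shows "\<exists>I. ((\<lambda>t. sin (w * t)) has_integral I) {s..s + l} \<and> \<bar>I\<bar> \<le> R * e * l"
proof -
  have "(\<lambda>t. sin (w * t)) integrable_on {s..s + l}"
    by (intro integrable_continuous_real continuous_intros)
  then obtain I where I: "((\<lambda>t. sin (w * t)) has_integral I) {s..s + l}" by blast
  have "\<bar>sin (w * t)\<bar> \<le> R * e" if "t \<in> {s..s + l}" for t
  proof -
    have "\<bar>sin (w * t)\<bar> \<le> \<bar>w\<bar> * \<bar>t\<bar>" using abs_sin_x_le_abs_x[of "w * t"] by (simp add: abs_mult)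
    also have "\<dots> \<le> R * e" using assms that by (intro mult_mono) auto
    finally show ?thesis .
  qed
  moreover have "0 \<le> R * e" using assms by auto
  ultimately have "norm I \<le> R * e * measure lborel {s..s + l}"
    using I by (intro has_integral_bound_real[where S = "{}"]) auto
  then show ?thesis using I assms by auto
qed

lemma cos_integral_near:
  fixes s l e w R :: real
  assumes "0 \<le> s" "0 \<le> l" "s + l \<le> e" "\<bar>w\<bar> \<le> R"
  shows "\<exists>I. ((\<lambda>t. cos (w * t)) has_integral I) {s..s + l} \<and> \<bar>I - l\<bar> \<le> R * e * l"
proof -
  have "(\<lambda>t. cos (w * t)) integrable_on {s..s + l}"
    by (intro integrable_continuous_real continuous_intros)
  then obtain I where I: "((\<lambda>t. cos (w * t)) has_integral I) {s..s + l}" by blast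
  have I1: "((\<lambda>t. cos (w * t) - 1) has_integral (I - l)) {s..s + l}"
    using has_integral_diff[OF I has_integral_const_real[of 1 s "s + l"]] assms by simp
  have "\<bar>cos (w * t) - 1\<bar> \<le> R * e" if "t \<in> {s..s + l}" for t
  proof -
    have "\<bar>cos (w * t) - 1\<bar> = 2 * \<bar>sin (w * t / 2)\<bar> * \<bar>sin (w * t / 2)\<bar>"
      using cos_double_sin[of "w * t / 2"] by (simp add: power2_eq_square abs_mult)
    also have "\<dots> \<le> 2 * \<bar>w * t / 2\<bar> * 1"
      using abs_sin_x_le_abs_x[of "w * t / 2"] by (intro mult_mono) auto
    also have "\<dots> = \<bar>w\<bar> * \<bar>t\<bar>" by (simp add: abs_mult)
    also have "\<dots> \<le> R * e" using assms that by (intro mult_mono) auto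
    finally show ?thesis .
  qed
  moreover have "0 \<le> R * e" using assms by auto
  ultimately have "norm (I - l) \<le> R * e * measure lborel {s..s + l}"
    using I1 by (intro has_integral_bound_real[where S = "{}"]) auto
  then show ?thesis using I assms by auto
qed

text \<open>The antiderivative gives a bound independent of \<open>l\<close>, so it is of use only
  when \<open>R\<close> is large compared with \<open>1 / l\<close>; the ratio
  \<open>\<Gamma>\<close> will ensure this.\<close>

lemma sin_cos_integral_far:
  fixes s l w R :: real
  assumes "0 \<le> l" "0 < R" "R \<le> \<bar>w\<bar>"
  shows "\<exists>I. ((\<lambda>t. sin (w * t)) has_integral I) {s..s + l} \<and> \<bar>I\<bar> \<le> 2 / R"
    and "\<exists>I. ((\<lambda>t. cos (w * t)) has_integral I) {s..s + l} \<and> \<bar>I\<bar> \<le> 2 / R"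
proof -
  have w: "w \<noteq> 0" using assms by auto
  have R: "\<bar>x / w\<bar> \<le> 2 / R" if "\<bar>x\<bar> \<le> 2" for x
    using that assms by (simp add: abs_divide) (intro frac_le, auto)
  have "((\<lambda>t. sin (w * t)) has_integral (- cos (w * (s + l)) / w - (- cos (w * s) / w))) {s..s + l}"
    by (rule fundamental_theorem_of_calculus)
      (use assms w in \<open>auto intro!: derivative_eq_intros simp flip: has_real_derivative_iff_has_vector_derivative\<close>)
  moreover have "- cos (w * (s + l)) / w - (- cos (w * s) / w) = (cos (w * s) - cos (w * (s + l))) / w"
    by (simp add: diff_divide_distrib)
  moreover have "\<bar>cos (w * s) - cos (w * (s + l))\<bar> \<le> 2"
    using abs_cos_le_one[of "w * s"] abs_cos_le_one[of "w * (s + l)"] by linarith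
  ultimately show "\<exists>I. ((\<lambda>t. sin (w * t)) has_integral I) {s..s + l} \<and> \<bar>I\<bar> \<le> 2 / R"
    using R by metis
  have "((\<lambda>t. cos (w * t)) has_integral (sin (w * (s + l)) / w - sin (w * s) / w)) {s..s + l}"
    by (rule fundamental_theorem_of_calculus)
      (use assms w in \<open>auto intro!: derivative_eq_intros simp flip: has_real_derivative_iff_has_vector_derivative\<close>)
  moreover have "sin (w * (s + l)) / w - sin (w * s) / w = (sin (w * (s + l)) - sin (w * s)) / w"
    by (simp add: diff_divide_distrib)
  moreover have "\<bar>sin (w * (s + l)) - sin (w * s)\<bar> \<le> 2"
    using abs_sin_le_one[of "w * s"] abs_sin_le_one[of "w * (s + l)"] by linarith
  ultimately show "\<exists>I. ((\<lambda>t. cos (w * t)) has_integral I) {s..s + l} \<and> \<bar>I\<bar> \<le> 2 / R"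
    using R by metis
qed

lemma zero_free_subinterval:
  fixes Z :: "real set"
  assumes "finite Z" "card Z \<le> M" "0 < e"
  shows "\<exists>s\<ge>0. s + e / (real M + 1) \<le> e \<and> {s<..<s + e / (real M + 1)} \<inter> Z = {}"
proof -
  define l where "l = e / (real M + 1)"
  have "real M + 1 \<noteq> 0" by linarith
  then have l: "0 < l" "real (M + 1) * l = e"
    using assms by (simp_all add: l_def nonzero_eq_divide_eq nonzero_divide_eq_eq add.commute)
  have "{real i * l<..<real (Suc i) * l} \<inter> {real j * l<..<real (Suc j) * l} = {}" if "i < j" for i j
  proof -
    have "real (Suc i) * l \<le> real j * l" using that l by (intro mult_right_mono) auto
    then show ?thesis by auto
  qed
  then have "{real i * l<..<real (Suc i) * l} \<inter> {real j * l<..<real (Suc j) * l} = {}" if "i \<noteq> j" for i j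
    using that by (metis Int_commute linorder_neqE_nat)
  then obtain i where i: "i \<le> M" "\<forall>d\<in>Z. d \<notin> {real i * l<..<real (Suc i) * l}"
    using disjoint_family_avoids[OF assms(1,2), of "\<lambda>i. {real i * l<..<real (Suc i) * l}"] by blast
  have "real (Suc i) * l \<le> real (M + 1) * l" using i l by (intro mult_right_mono) auto
  moreover have "real (Suc i) * l = real i * l + l" by (simp add: algebra_simps)
  ultimately have "real i * l + l \<le> e" using l(2) by linarith
  moreover have "{real i * l<..<real i * l + l} \<inter> Z = {}"
    using i(2) by (auto simp: algebra_simps)
  ultimately show ?thesis
    using l(1) unfolding l_def[symmetric] by (intro exI[of _ "real i * l"]) simp
qed

lemma continuous_constant_sign:
  fixes h :: "real \<Rightarrow> real"
  assumes "continuous_on {s..u} h" "\<And>t. s < t \<Longrightarrow> t < u \<Longrightarrow> h t \<noteq> 0"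
  shows "(\<forall>t\<in>{s..u}. 0 \<le> h t) \<or> (\<forall>t\<in>{s..u}. h t \<le> 0)"
proof (rule ccontr)
  assume "\<not> ?thesis"
  then obtain x y where xy: "x \<in> {s..u}" "y \<in> {s..u}" "h x < 0" "0 < h y"
    by (auto simp: not_le)
  have "\<exists>t. min x y \<le> t \<and> t \<le> max x y \<and> h t = 0"
  proof (cases "x \<le> y")
    case True
    then show ?thesis
      using IVT'[of h x 0 y] xy continuous_on_subset[OF assms(1), of "{x..y}"] by auto
  next
    case False
    then show ?thesis
      using IVT2'[of h x 0 y] xy continuous_on_subset[OF assms(1), of "{y..x}"] by auto
  qed
  then obtain t where t: "min x y \<le> t" "t \<le> max x y" "h t = 0" by blast
  then have "t \<noteq> x" "t \<noteq> y" using xy by auto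
  then have "s < t" "t < u" using t xy by (auto simp: min_def max_def split: if_splits)
  then show False using assms(2) t(3) by blast
qed

locale even_sequence =
  fixes \<alpha> :: "int \<Rightarrow> real" and K :: nat
  assumes even: "\<alpha> (- j) = \<alpha> j" and fin: "finite {j. \<alpha> j \<noteq> 0}" and K: "1 \<le> K"
begin

definition b :: "int \<Rightarrow> real" where "b j = \<alpha> (j + int K) - \<alpha> j"
definition J :: "int set" where "J = {j. b j \<noteq> 0}"
text \<open>The shift by half a period makes the frequencies symmetric: under
  \<open>j \<mapsto> - j - K\<close> both \<open>w\<close> and \<open>b\<close> change sign, which
  leaves a pure sine sum.\<close>

definition w :: "int \<Rightarrow> real" where "w j = real_of_int j + real K / 2"
definition W :: "int \<Rightarrow> real" where "W u = (\<Sum>j\<in>{u..<u + int K}. \<alpha> j)"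

lemma finite_J: "finite J"
proof (rule finite_subset)
  let ?A = "{j. \<alpha> j \<noteq> 0}"
  show "J \<subseteq> ?A \<union> (\<lambda>j. j - int K) ` ?A"
  proof
    fix j assume "j \<in> J"
    then have "\<alpha> j \<noteq> 0 \<or> \<alpha> (j + int K) \<noteq> 0" by (auto simp: J_def b_def)
    then show "j \<in> ?A \<union> (\<lambda>j. j - int K) ` ?A"
      using image_eqI[of j "\<lambda>j. j - int K" "j + int K" ?A] by auto
  qed
qed (use fin in auto)

lemma sum_b:
  "(\<Sum>j\<in>J. b j * g (w j)) = (\<Sum>j | \<alpha> j \<noteq> 0. \<alpha> j * (g (real_of_int j - real K / 2) - g (real_of_int j + real K / 2)))"
proof -
  let ?A = "{j. \<alpha> j \<noteq> 0}"
  define B where "B = J \<union> ?A \<union> (\<lambda>j. j - int K) ` ?A"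
  have fB: "finite B" using finite_J fin by (simp add: B_def)
  have "(\<Sum>j\<in>J. b j * g (w j)) = (\<Sum>j\<in>B. b j * g (w j))"
    by (rule sum.mono_neutral_left[OF fB]) (auto simp: B_def J_def)
  also have "\<dots> = (\<Sum>j\<in>B. \<alpha> (j + int K) * g (w j)) - (\<Sum>j\<in>B. \<alpha> j * g (w j))"
    by (simp add: b_def left_diff_distrib sum_subtractf)
  also have "(\<Sum>j\<in>B. \<alpha> (j + int K) * g (w j)) = (\<Sum>j\<in>(\<lambda>j. j - int K) ` ?A. \<alpha> (j + int K) * g (w j))"
  proof (rule sum.mono_neutral_right[OF fB], simp add: B_def, rule ballI)
    fix j assume "j \<in> B - (\<lambda>j. j - int K) ` ?A"
    then have "j + int K \<notin> ?A" using image_eqI[of j "\<lambda>j. j - int K" "j + int K" ?A] by auto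
    then show "\<alpha> (j + int K) * g (w j) = 0" by simp
  qed
  also have "\<dots> = (\<Sum>j\<in>?A. \<alpha> j * g (real_of_int j - real K / 2))"
    by (subst sum.reindex) (auto simp: inj_on_def w_def intro!: sum.cong arg_cong[of _ _ g])
  also have "(\<Sum>j\<in>B. \<alpha> j * g (w j)) = (\<Sum>j\<in>?A. \<alpha> j * g (real_of_int j + real K / 2))"
    unfolding w_def by (rule sum.mono_neutral_right[OF fB]) (auto simp: B_def)
  finally show ?thesis by (simp add: right_diff_distrib sum_subtractf)
qed

lemma sum_b_sin: "(\<Sum>j\<in>J. b j * sin (w j * t)) = - 2 * sin (real K / 2 * t) * cos_sum \<alpha> t"
proof -
  have "sin ((real_of_int j - real K / 2) * t) - sin ((real_of_int j + real K / 2) * t)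
      = - 2 * sin (real K / 2 * t) * cos (real_of_int j * t)" for j
    by (simp add: left_diff_distrib distrib_right sin_add sin_diff)
  then show ?thesis
    unfolding sum_b[of "\<lambda>x. sin (x * t)"] cos_sum_def sum_distrib_left
    by (intro sum.cong refl) (simp only: mult_ac)
qed

text \<open>The sine sum of an even sequence vanishes. This identity later reduces a cosine sum with
  frequencies \<open>w j - w j0\<close> to one product of sines, and at \<open>t = 0\<close> it
  gives the total sum of \<open>b\<close>.\<close>

lemma sum_b_cos: "(\<Sum>j\<in>J. b j * cos (w j * t)) = 0"
proof -
  let ?A = "{j. \<alpha> j \<noteq> 0}"
  have "cos ((real_of_int j - real K / 2) * t) - cos ((real_of_int j + real K / 2) * t)
      = 2 * sin (real K / 2 * t) * sin (real_of_int j * t)" for j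
    by (simp add: left_diff_distrib distrib_right cos_add cos_diff)
  then have "(\<Sum>j\<in>J. b j * cos (w j * t)) = 2 * sin (real K / 2 * t) * (\<Sum>j\<in>?A. \<alpha> j * sin (real_of_int j * t))"
    using sum_b[of "\<lambda>x. cos (x * t)"] by (simp add: sum_distrib_left algebra_simps)
  moreover have "(\<Sum>j\<in>?A. \<alpha> j * sin (real_of_int j * t)) = 0"
  proof -
    have "(\<Sum>j\<in>?A. \<alpha> j * sin (real_of_int j * t)) = (\<Sum>j\<in>?A. \<alpha> (- j) * sin (real_of_int (- j) * t))"
      by (rule sum.reindex_bij_witness[of _ uminus uminus]) (use even in auto)
    also have "\<dots> = - (\<Sum>j\<in>?A. \<alpha> j * sin (real_of_int j * t))"
      by (simp add: even sum_negf)
    finally show ?thesis by simp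
  qed
  ultimately show ?thesis by simp
qed

lemma sum_b_zero: "(\<Sum>j\<in>J. b j) = 0"
  using sum_b_cos[of 0] by simp

text \<open>Telescoping: \<open>W (u + 1) - W u = b u\<close>, and \<open>W\<close> vanishes far to
  the left.\<close>

lemma W_eq: "W u = (\<Sum>j | j \<in> J \<and> j < u. b j)"
proof -
  obtain L where L: "\<And>j. \<alpha> j \<noteq> 0 \<Longrightarrow> L \<le> j"
  proof -
    have "finite ({j. \<alpha> j \<noteq> 0})" by (rule fin)
    then have "bdd_below {j. \<alpha> j \<noteq> 0}" by (rule bdd_below_finite)
    then show ?thesis using that unfolding bdd_below_def by blast
  qed
  have base: "W v = (\<Sum>j | j \<in> J \<and> j < v. b j)" if v: "v \<le> L - int K" for v
  proof -
    have "W v = 0" unfolding W_def by (rule sum.neutral) (use L v in force)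
    moreover have "b j = 0" if "j < v" for j
      using L[of j] L[of "j + int K"] that v by (force simp: b_def)
    then have "{j. j \<in> J \<and> j < v} = {}"
      by (auto simp: J_def)
    ultimately show ?thesis by (metis sum.empty)
  qed
  show ?thesis
  proof (cases "u \<le> L - int K")
    case True
    then show ?thesis by (rule base)
  next
    case False
    then have "L - int K \<le> u" by simp
    then show ?thesis
    proof (induction u rule: int_ge_induct)
      case base
      then show ?case using \<open>\<And>v. v \<le> L - int K \<Longrightarrow> W v = (\<Sum>j | j \<in> J \<and> j < v. b j)\<close> by simp
    next
      case (step i)
      have "{i..<i + int K} = insert i {i + 1..<i + int K}" "{i + 1..<i + 1 + int K} = insert (i + int K) {i + 1..<i + int K}"
        using K by auto
      then have "W (i + 1) = W i + b i" by (simp add: W_def b_def)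
      moreover have "(\<Sum>j | j \<in> J \<and> j < i + 1. b j) = (\<Sum>j | j \<in> J \<and> j < i. b j) + b i"
      proof (cases "i \<in> J")
        case True
        then have "{j. j \<in> J \<and> j < i + 1} = insert i {j. j \<in> J \<and> j < i}" by auto
        then show ?thesis using finite_J by simp
      next
        case False
        then have "{j. j \<in> J \<and> j < i + 1} = {j. j \<in> J \<and> j < i}" by (auto simp: less_le)
        then show ?thesis using False by (simp add: J_def)
      qed
      ultimately show ?case using step by simp
    qed
  qed
qed

text \<open>An equivalence class as soon as no two frequencies have a distance above
  \<open>R\<close> and at most \<open>2 * R\<close>.\<close>

definition clump :: "real \<Rightarrow> int \<Rightarrow> int set" where
  "clump R j = {k \<in> J. \<bar>w k - w j\<bar> \<le> R}"

text \<open>The partial sum of \<open>b\<close> below \<open>u\<close> is composed of full clumps,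
  and so is 0, unless \<open>u\<close> cuts a clump; then \<open>u\<close> is within
  \<open>R\<close> of an element of \<open>J\<close>. A clump near frequency 0 is treated as the
  complement of all others.\<close>

lemma window_sum_support:
  assumes R: "0 \<le> R" and pair: "\<And>j k. j \<in> J \<Longrightarrow> k \<in> J \<Longrightarrow> \<bar>w k - w j\<bar> \<le> 2 * R \<Longrightarrow> \<bar>w k - w j\<bar> \<le> R"
    and clumps: "\<And>j. j \<in> J \<Longrightarrow> R < \<bar>w j\<bar> \<Longrightarrow> sum b (clump R j) = 0"
  shows "card {u. W u \<noteq> 0} \<le> card J * (2 * nat \<lfloor>R\<rfloor> + 1)"
proof -
  have self: "j \<in> clump R j" if "j \<in> J" for j using that R by (simp add: clump_def)
  have trans: "clump R k = clump R j" if "j \<in> J" "k \<in> clump R j" for j k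
  proof -
    have "\<bar>w l - w k\<bar> \<le> R \<longleftrightarrow> \<bar>w l - w j\<bar> \<le> R" if "l \<in> J" for l
      using pair[of k l] pair[of j l] that \<open>j \<in> J\<close> \<open>k \<in> clump R j\<close> by (fastforce simp: clump_def)
    then show ?thesis by (auto simp: clump_def)
  qed
  have union: "sum b A = 0"
    if A: "A \<subseteq> J" "\<And>a. a \<in> A \<Longrightarrow> clump R a \<subseteq> A" "\<And>a. a \<in> A \<Longrightarrow> sum b (clump R a) = 0" for A
  proof -
    have "sum b A = (\<Sum>y\<in>clump R ` A. sum b {x \<in> A. clump R x = y})"
      by (rule sum.image_gen) (use A(1) finite_J finite_subset in blast)
    also have "\<dots> = (\<Sum>y\<in>clump R ` A. 0)"
    proof (rule sum.cong[OF refl], clarify)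
      fix a assume a: "a \<in> A"
      have "{x \<in> A. clump R x = clump R a} = clump R a"
        using A(1,2) a self trans by blast
      then show "sum b {x \<in> A. clump R x = clump R a} = 0" using A(3)[OF a] by simp
    qed
    finally show ?thesis by simp
  qed
  have all: "sum b (clump R j) = 0" if j: "j \<in> J" for j
  proof (cases "R < \<bar>w j\<bar>")
    case True
    then show ?thesis using clumps j by blast
  next
    case False
    \<comment> \<open>Two frequencies of modulus at most \<open>R\<close> are within
      \<open>2 * R\<close> of each other, so there is only one central clump.\<close>
    have noncentral: "R < \<bar>w k\<bar>" if "k \<in> J - clump R j" for k
    proof (rule ccontr)
      assume "\<not> R < \<bar>w k\<bar>"
      then have "\<bar>w k - w j\<bar> \<le> 2 * R" using False by linarith
      then show False using pair[of j k] that j by (auto simp: clump_def)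
    qed
    have "sum b (J - clump R j) = 0"
    proof (rule union)
      fix a assume a: "a \<in> J - clump R j"
      show "clump R a \<subseteq> J - clump R j"
      proof
        fix k assume k: "k \<in> clump R a"
        have "k \<notin> clump R j"
          using trans[OF j, of k] trans[OF _ k] self[of a] a by blast
        then show "k \<in> J - clump R j" using k by (simp add: clump_def)
      qed
      show "sum b (clump R a) = 0" using clumps noncentral[OF a] a by blast
    qed auto
    moreover have "clump R j \<subseteq> J" by (auto simp: clump_def)
    ultimately show ?thesis
      using sum_b_zero sum.subset_diff[of "clump R j" J b] finite_J by simp
  qed
  have "{u. W u \<noteq> 0} \<subseteq> (\<Union>j\<in>J. {j - \<lfloor>R\<rfloor>..j + \<lfloor>R\<rfloor>})"
  proof
    fix u assume "u \<in> {u. W u \<noteq> 0}"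
    then have "sum b {j. j \<in> J \<and> j < u} \<noteq> 0" using W_eq by simp
    then have "\<not> (\<forall>a\<in>{j. j \<in> J \<and> j < u}. clump R a \<subseteq> {j. j \<in> J \<and> j < u})"
      using union[of "{j. j \<in> J \<and> j < u}"] all by blast
    then obtain a k where a: "a \<in> J" "a < u" and k: "k \<in> clump R a" "\<not> (k \<in> J \<and> k < u)"
      by blast
    then have "u \<le> k" by (simp add: clump_def)
    have "real_of_int (k - u) \<le> R" using k(1) a by (simp add: clump_def w_def abs_le_iff)
    then have "k - u \<le> \<lfloor>R\<rfloor>" by linarith
    then have "u \<in> {k - \<lfloor>R\<rfloor>..k + \<lfloor>R\<rfloor>}" using \<open>u \<le> k\<close> R by simp
    moreover have "k \<in> J" using k(1) by (simp add: clump_def)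
    ultimately show "u \<in> (\<Union>j\<in>J. {j - \<lfloor>R\<rfloor>..j + \<lfloor>R\<rfloor>})" by blast
  qed
  then have "card {u. W u \<noteq> 0} \<le> card (\<Union>j\<in>J. {j - \<lfloor>R\<rfloor>..j + \<lfloor>R\<rfloor>})"
    using finite_J by (intro card_mono) auto
  also have "\<dots> \<le> (\<Sum>j\<in>J. card {j - \<lfloor>R\<rfloor>..j + \<lfloor>R\<rfloor>})"
    by (rule card_UN_le[OF finite_J])
  also have "\<dots> = card J * (2 * nat \<lfloor>R\<rfloor> + 1)"
    using R by (simp add: nat_add_distrib nat_mult_distrib)
  finally show ?thesis .
qed

text \<open>On an interval free of zeros, \<open>h = \<Sum> b j sin (w j t)\<close> has constant sign, so its integral dominates
  that of \<open>h\<close> against \<open>sin (w j0 t)\<close>.  The former is small because the low frequencies contribute little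
  near \<open>0\<close> and the high ones oscillate; the latter sees the total mass of the clump of \<open>j0\<close>.\<close>

lemma clump_sum_bound:
  fixes \<Gamma> R \<beta> s l e :: real
  assumes j0: "j0 \<in> J" "\<Gamma> * R < \<bar>w j0\<bar>" and R: "0 < R" "0 < \<Gamma>"
    and pair: "\<And>j. j \<in> J \<Longrightarrow> \<bar>w j - w j0\<bar> \<le> R \<or> \<Gamma> * R < \<bar>w j - w j0\<bar>"
    and central: "\<And>j. j \<in> J \<Longrightarrow> \<bar>w j\<bar> \<le> R \<or> \<Gamma> * R < \<bar>w j\<bar>"
    and \<beta>: "\<And>j. j \<in> J \<Longrightarrow> \<bar>b j\<bar> \<le> \<beta>"
    and interval: "0 \<le> s" "0 < l" "s + l \<le> e" "real K * e < 2 * pi"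
    and free: "\<And>t. s < t \<Longrightarrow> t < s + l \<Longrightarrow> cos_sum \<alpha> t \<noteq> 0"
  shows "l * \<bar>sum b (clump R j0)\<bar> \<le> 2 * card J * \<beta> * (R * e * l + 2 / (\<Gamma> * R))"
proof -
  have \<beta>0: "0 \<le> \<beta>" using \<beta>[OF j0(1)] by linarith
  have e: "0 < e" using interval by linarith
  have \<Gamma>R: "0 < \<Gamma> * R" using R by simp
  define h where "h = (\<lambda>t. \<Sum>j\<in>J. b j * sin (w j * t))"
  define \<rho> where "\<rho> = R * e * l + 2 / (\<Gamma> * R)"
  have \<rho>: "R * e * l \<le> \<rho>" "2 / (\<Gamma> * R) \<le> \<rho>" using R \<Gamma>R e interval by (simp_all add: \<rho>_def)
  have "\<exists>I. ((\<lambda>t. sin (w j * t)) has_integral I) {s..s + l} \<and> \<bar>I\<bar> \<le> \<rho>" if "j \<in> J" for j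
    using central[OF that] sin_integral_near[of s l e "w j" R] sin_cos_integral_far(1)[of l "\<Gamma> * R" "w j" s]
      interval \<Gamma>R \<rho> by (meson less_imp_le order_trans)
  then obtain I where I: "\<And>j. j \<in> J \<Longrightarrow> ((\<lambda>t. sin (w j * t)) has_integral I j) {s..s + l}"
    "\<And>j. j \<in> J \<Longrightarrow> \<bar>I j\<bar> \<le> \<rho>" by metis
  \<comment> \<open>The main term of the cosine integral: about the full length for frequencies near
    \<open>w j0\<close>, about 0 for the others.\<close>
  define m where "m = (\<lambda>j. if j \<in> clump R j0 then l else 0)"
  have "\<exists>I. ((\<lambda>t. cos ((w j - w j0) * t)) has_integral I) {s..s + l} \<and> \<bar>I - m j\<bar> \<le> \<rho>" if "j \<in> J" for j
  proof (cases "j \<in> clump R j0")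
    case True
    then show ?thesis
      using cos_integral_near[of s l e "w j - w j0" R] interval \<rho> by (force simp: m_def clump_def)
  next
    case False
    then have "\<Gamma> * R < \<bar>w j - w j0\<bar>" using pair[OF that] that by (simp add: clump_def)
    then show ?thesis
      using sin_cos_integral_far(2)[of l "\<Gamma> * R" "w j - w j0" s] interval \<Gamma>R \<rho> False
      by (force simp: m_def)
  qed
  then obtain I' where I': "\<And>j. j \<in> J \<Longrightarrow> ((\<lambda>t. cos ((w j - w j0) * t)) has_integral I' j) {s..s + l}"
    "\<And>j. j \<in> J \<Longrightarrow> \<bar>I' j - m j\<bar> \<le> \<rho>" by metis
  have small: "\<bar>\<Sum>j\<in>J. b j * x j\<bar> \<le> card J * \<beta> * \<rho>" if "\<And>j. j \<in> J \<Longrightarrow> \<bar>x j\<bar> \<le> \<rho>" for x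
  proof -
    have "\<bar>\<Sum>j\<in>J. b j * x j\<bar> \<le> (\<Sum>j\<in>J. \<beta> * \<rho>)"
      by (rule order_trans[OF sum_abs], rule sum_mono)
        (use \<beta> that \<beta>0 in \<open>auto simp: abs_mult intro!: mult_mono\<close>)
    then show ?thesis by simp
  qed
  have h: "(h has_integral (\<Sum>j\<in>J. b j * I j)) {s..s + l}"
    unfolding h_def by (intro has_integral_sum finite_J has_integral_mult_right I)
  have "((\<lambda>t. \<Sum>j\<in>J. b j * cos ((w j - w j0) * t)) has_integral (\<Sum>j\<in>J. b j * I' j)) {s..s + l}"
    by (intro has_integral_sum finite_J has_integral_mult_right I')
  moreover have "(\<Sum>j\<in>J. b j * cos ((w j - w j0) * t)) = h t * sin (w j0 * t)" for t
  proof -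
    have "(\<Sum>j\<in>J. b j * cos ((w j - w j0) * t))
       = cos (w j0 * t) * (\<Sum>j\<in>J. b j * cos (w j * t)) + sin (w j0 * t) * (\<Sum>j\<in>J. b j * sin (w j * t))"
      by (simp add: left_diff_distrib cos_diff sum_distrib_left distrib_left sum.distrib algebra_simps)
    then show ?thesis by (simp add: sum_b_cos h_def)
  qed
  ultimately have h': "((\<lambda>t. h t * sin (w j0 * t)) has_integral (\<Sum>j\<in>J. b j * I' j)) {s..s + l}"
    by simp
  have sign: "(\<forall>t\<in>{s..s + l}. 0 \<le> h t) \<or> (\<forall>t\<in>{s..s + l}. h t \<le> 0)"
  proof (rule continuous_constant_sign)
    show "continuous_on {s..s + l} h" unfolding h_def by (intro continuous_intros)
    fix t assume t: "s < t" "t < s + l"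
    \<comment> \<open>By \<open>sum_b_sin\<close>, \<open>h\<close> has a sine as a second factor;
      \<open>real K * e < 2 * pi\<close> keeps that sine positive, so it adds no zeros.\<close>
    have "0 < real K / 2 * t" using K t interval by simp
    moreover have "real K / 2 * t < pi"
    proof -
      have "real K * t \<le> real K * e" using t interval by (intro mult_left_mono) auto
      then show ?thesis using interval by simp
    qed
    ultimately have "0 < sin (real K / 2 * t)" by (rule sin_gt_zero)
    then show "h t \<noteq> 0"
      using free[OF t] unfolding h_def sum_b_sin by simp
  qed
  have *: "\<bar>\<Sum>j\<in>J. b j * I' j\<bar> \<le> \<bar>\<Sum>j\<in>J. b j * I j\<bar>"
  proof -
    have ts: "\<bar>h t * sin (w j0 * t)\<bar> \<le> \<bar>h t\<bar>" for t
      using mult_left_mono[OF abs_sin_le_one[of "w j0 * t"], of "\<bar>h t\<bar>"] by (simp add: abs_mult)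
    have hn: "((\<lambda>t. - h t) has_integral - (\<Sum>j\<in>J. b j * I j)) {s..s + l}"
      using has_integral_neg[OF h] .
    from sign show ?thesis
    proof
      assume pos: "\<forall>t\<in>{s..s + l}. 0 \<le> h t"
      have hs: "h t * sin (w j0 * t) \<le> h t" "- h t \<le> h t * sin (w j0 * t)" if "t \<in> {s..s + l}" for t
        using ts[of t] bspec[OF pos that] by linarith+
      show ?thesis
        using has_integral_le[OF h' h hs(1)] has_integral_le[OF hn h' hs(2)] by linarith
    next
      assume neg: "\<forall>t\<in>{s..s + l}. h t \<le> 0"
      have hs: "h t * sin (w j0 * t) \<le> - h t" "h t \<le> h t * sin (w j0 * t)" if "t \<in> {s..s + l}" for t
        using ts[of t] bspec[OF neg that] by linarith+
      show ?thesis
        using has_integral_le[OF h' hn hs(1)] has_integral_le[OF h h' hs(2)] by linarith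
    qed
  qed
  have "(\<Sum>j\<in>J. b j * m j) = l * sum b (clump R j0)"
  proof -
    have "(\<Sum>j\<in>J. b j * m j) = (\<Sum>j\<in>clump R j0. b j * m j)"
      by (rule sum.mono_neutral_right[OF finite_J]) (auto simp: m_def clump_def)
    then show ?thesis by (simp add: m_def sum_distrib_left mult.commute)
  qed
  moreover have "(\<Sum>j\<in>J. b j * I' j) - (\<Sum>j\<in>J. b j * m j) = (\<Sum>j\<in>J. b j * (I' j - m j))"
    by (simp add: right_diff_distrib sum_subtractf)
  ultimately have "\<bar>l * sum b (clump R j0)\<bar> \<le> card J * \<beta> * \<rho> + card J * \<beta> * \<rho>"
    using * small[of I, OF I(2)] small[of "\<lambda>j. I' j - m j", OF I'(2)] by linarith
  moreover have "2 * card J * \<beta> * \<rho> = card J * \<beta> * \<rho> + card J * \<beta> * \<rho>" by simp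
  moreover have "\<bar>l * sum b (clump R j0)\<bar> = l * \<bar>sum b (clump R j0)\<bar>"
    using interval by (simp add: abs_mult)
  ultimately show ?thesis unfolding \<rho>_def[symmetric] by linarith
qed

end

lemma almost_periodic_few_window_sums:
  fixes S :: "real set"
  assumes S: "finite S" and K: "1 \<le> K"
  shows "\<exists>B. \<forall>\<alpha>. (\<forall>j. \<alpha> j \<in> S) \<longrightarrow> (\<forall>j. \<alpha> (- j) = \<alpha> j) \<longrightarrow> finite {j. \<alpha> j \<noteq> 0} \<longrightarrow>
    finite {t. 0 < t \<and> t < pi \<and> cos_sum \<alpha> t = 0} \<longrightarrow>
    card {t. 0 < t \<and> t < pi \<and> cos_sum \<alpha> t = 0} \<le> M \<longrightarrow>
    card {j. \<alpha> (j + int K) \<noteq> \<alpha> j} \<le> N \<longrightarrow>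
    card {u. (\<Sum>j\<in>{u..<u + int K}. \<alpha> j) \<noteq> 0} \<le> B"
proof -
  define D where "D = (\<lambda>(u, v). u - v) ` (S \<times> S)"
  have fD: "finite D" using S by (simp add: D_def)
  obtain T where T: "finite T" "0 \<in> T"
    "\<And>A f. finite (A::int set) \<Longrightarrow> card A \<le> N \<Longrightarrow> f ` A \<subseteq> D \<Longrightarrow> sum f A \<in> T"
    using finite_bounded_sums[OF fD] by metis
  obtain \<delta> where \<delta>: "0 < \<delta>" "\<And>u v. u \<in> T \<Longrightarrow> v \<in> T \<Longrightarrow> \<bar>u - v\<bar> < \<delta> \<Longrightarrow> u = v"
    using finite_set_separation[OF T(1)] by blast
  obtain \<beta> where \<beta>: "0 < \<beta>" "\<And>v. v \<in> D \<Longrightarrow> \<bar>v\<bar> \<le> \<beta>"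
    using finite_imp_bounded[OF fD] unfolding bounded_pos by auto
  define N' where "N' = real (N + 1)"
  \<comment> \<open>\<open>q\<close> will be the product \<open>R * e\<close>. The first bound
    limits the low-frequency error to \<open>\<delta> / 4\<close> per unit of length, the second
    gives \<open>real K * e \<le> 1\<close>.\<close>
  define q where "q = min (\<delta> / (8 * N' * \<beta>)) (1 / real K)"
  \<comment> \<open>With \<open>l = q / (R * (M + 1))\<close>, this makes the oscillation error
    \<open>4 * N' * \<beta> / (\<Gamma> * R)\<close> at most \<open>l * \<delta> / 8\<close>. The 3
    provides the gap up to \<open>2 * R\<close> that clumps need.\<close>
  define \<Gamma> where "\<Gamma> = max 3 (32 * N' * \<beta> * (real M + 1) / (q * \<delta>))"
  have N': "0 < N'" by (simp add: N'_def)
  have q: "0 < q" "q \<le> \<delta> / (8 * N' * \<beta>)" "q \<le> 1 / real K"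
    using \<delta> \<beta> N' K by (auto simp: q_def)
  have \<Gamma>: "3 \<le> \<Gamma>" "32 * N' * \<beta> * (real M + 1) / (q * \<delta>) \<le> \<Gamma>" by (auto simp: \<Gamma>_def)
  define k where "k = N * N + N"
  show ?thesis
  proof (intro exI[of _ "N * (2 * nat \<lfloor>\<Gamma> ^ k\<rfloor> + 1)"] allI impI)
    fix \<alpha> :: "int \<Rightarrow> real"
    assume \<alpha>: "\<forall>j. \<alpha> j \<in> S" "\<forall>j. \<alpha> (- j) = \<alpha> j" "finite {j. \<alpha> j \<noteq> 0}"
      and Z: "finite {t. 0 < t \<and> t < pi \<and> cos_sum \<alpha> t = 0}"
        "card {t. 0 < t \<and> t < pi \<and> cos_sum \<alpha> t = 0} \<le> M"
      and cJ: "card {j. \<alpha> (j + int K) \<noteq> \<alpha> j} \<le> N"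
    interpret even_sequence \<alpha> K by standard (use \<alpha> K in auto)
    have cJ: "card J \<le> N" using cJ by (simp add: J_def b_def)
    have bD: "b j \<in> D" for j using \<alpha>(1) by (force simp: b_def D_def)
    define E where "E = (\<lambda>(i, j). \<bar>w i - w j\<bar>) ` (J \<times> J) \<union> (\<lambda>j. \<bar>w j\<bar>) ` J"
    have fE: "finite E" using finite_J by (simp add: E_def)
    have "card E \<le> card ((\<lambda>(i, j). \<bar>w i - w j\<bar>) ` (J \<times> J)) + card ((\<lambda>j. \<bar>w j\<bar>) ` J)"
      unfolding E_def by (rule card_Un_le)
    also have "\<dots> \<le> card (J \<times> J) + card J"
      by (intro add_mono card_image_le) (use finite_J in auto)
    also have "\<dots> \<le> k" unfolding k_def card_cartesian_product using cJ by (intro add_mono mult_mono) auto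
    finally have cE: "card E \<le> k" .
    have "{\<Gamma> ^ i<..\<Gamma> ^ Suc i} \<inter> {\<Gamma> ^ j<..\<Gamma> ^ Suc j} = {}" if "i < j" for i j
    proof -
      have "\<Gamma> ^ Suc i \<le> \<Gamma> ^ j" using that \<Gamma> by (intro power_increasing) auto
      then show ?thesis by auto
    qed
    then have "{\<Gamma> ^ i<..\<Gamma> ^ Suc i} \<inter> {\<Gamma> ^ j<..\<Gamma> ^ Suc j} = {}" if "i \<noteq> j" for i j
      using that by (metis Int_commute linorder_neqE_nat)
    then obtain i where i: "i \<le> k" "\<forall>d\<in>E. d \<notin> {\<Gamma> ^ i<..\<Gamma> ^ Suc i}"
      using disjoint_family_avoids[OF fE cE, of "\<lambda>i. {\<Gamma> ^ i<..\<Gamma> ^ Suc i}"] by blast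
    \<comment> \<open>No distance between frequencies and no modulus of a frequency lies above
      \<open>R\<close> and at most \<open>\<Gamma> * R\<close>. The scale depends on
      \<open>\<alpha>\<close>, but \<open>R \<le> \<Gamma> ^ k\<close> keeps the final bound
      uniform.\<close>
    define R where "R = \<Gamma> ^ i"
    have R: "1 \<le> R" "R \<le> \<Gamma> ^ k" using \<Gamma> i by (auto simp: R_def intro!: one_le_power power_increasing)
    have gap: "d \<le> R \<or> \<Gamma> * R < d" if "d \<in> E" for d
      using i(2) that by (force simp: R_def)
    have pair: "\<bar>w j - w j'\<bar> \<le> R \<or> \<Gamma> * R < \<bar>w j - w j'\<bar>" if "j \<in> J" "j' \<in> J" for j j'
      by (rule gap) (use that in \<open>auto simp: E_def\<close>)
    have central: "\<bar>w j\<bar> \<le> R \<or> \<Gamma> * R < \<bar>w j\<bar>" if "j \<in> J" for j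
      by (rule gap) (use that in \<open>auto simp: E_def\<close>)
    have two: "2 * R \<le> \<Gamma> * R" using \<Gamma> R by (intro mult_right_mono) auto
    define e where "e = q / R"
    have e: "0 < e" "e \<le> 1 / real K" "R * e = q"
    proof -
      show "0 < e" using q R by (simp add: e_def)
      have "q / R \<le> q / 1" using q R by (intro divide_left_mono) auto
      then show "e \<le> 1 / real K" using q by (simp add: e_def)
      show "R * e = q" using R by (simp add: e_def)
    qed
    have Ke: "real K * e \<le> 1" using e(2) K by (simp add: field_simps)
    have "e \<le> real K * e" using K e by simp
    then have epi: "e < pi" using Ke pi_gt3 by linarith
    obtain s where s: "0 \<le> s" "s + e / (real M + 1) \<le> e"
      "{s<..<s + e / (real M + 1)} \<inter> {t. 0 < t \<and> t < pi \<and> cos_sum \<alpha> t = 0} = {}"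
      using zero_free_subinterval[OF Z e(1)] by (elim exE conjE) (rule that)
    define l where "l = e / (real M + 1)"
    have l: "0 < l" using e by (simp add: l_def)
    have zero: "sum b (clump R j0) = 0" if j0: "j0 \<in> J" "R < \<bar>w j0\<bar>" for j0
    proof -
      have "l * \<bar>sum b (clump R j0)\<bar> \<le> 2 * card J * \<beta> * (R * e * l + 2 / (\<Gamma> * R))"
      proof (rule clump_sum_bound)
        show "\<Gamma> * R < \<bar>w j0\<bar>" using central[OF j0(1)] j0(2) by linarith
        show "real K * e < 2 * pi" using Ke pi_gt3 by linarith
        show "s + l \<le> e" using s by (simp add: l_def)
        fix t assume t: "s < t" "t < s + l"
        then have "0 < t" "t < pi" using s epi by (auto simp: l_def)
        then show "cos_sum \<alpha> t \<noteq> 0" using s(3) t by (auto simp: l_def)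
      qed (use j0 pair central \<beta> bD s l R \<Gamma> in auto)
      also have "\<dots> \<le> 2 * N' * \<beta> * (q * l + 2 / (\<Gamma> * R))"
        using cJ \<beta>(1) q l R \<Gamma> unfolding e(3) N'_def
        by (intro mult_right_mono add_nonneg_nonneg) auto
      also have "\<dots> \<le> l * (\<delta> / 2)"
      proof -
        have "2 * N' * \<beta> * q \<le> \<delta> / 4"
          using q(2) N' \<beta> by (simp add: field_simps)
        then have "2 * N' * \<beta> * q * l \<le> \<delta> / 4 * l"
          using l by (intro mult_right_mono) auto
        then have 1: "2 * N' * \<beta> * q * l \<le> l * \<delta> / 4" by (simp only: mult.commute times_divide_eq_right)
        have lR: "R * l * (real M + 1) = q"
        proof -
          have "real M + 1 \<noteq> 0" by linarith
          then have "l * (real M + 1) = e" by (simp add: l_def)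
          then show ?thesis using e(3) by (simp add: mult.assoc)
        qed
        have "32 * N' * \<beta> * (real M + 1) \<le> \<Gamma> * (q * \<delta>)"
          using \<Gamma>(2) q \<delta> by (simp add: field_simps)
        moreover have "\<Gamma> * (q * \<delta>) = \<Gamma> * R * l * \<delta> * (real M + 1)"
          unfolding lR[symmetric] by (simp only: mult_ac)
        ultimately have "32 * N' * \<beta> * (real M + 1) \<le> \<Gamma> * R * l * \<delta> * (real M + 1)"
          by simp
        then have "32 * N' * \<beta> \<le> \<Gamma> * R * l * \<delta>"
          by (rule mult_right_le_imp_le) linarith
        then have 2: "2 * N' * \<beta> * (2 / (\<Gamma> * R)) \<le> l * \<delta> / 8"
          using R \<Gamma> by (simp add: field_simps)
        have "2 * N' * \<beta> * (q * l + 2 / (\<Gamma> * R)) = 2 * N' * \<beta> * q * l + 2 * N' * \<beta> * (2 / (\<Gamma> * R))"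
          by (simp only: distrib_left mult.assoc)
        also have "\<dots> \<le> l * \<delta> / 4 + l * \<delta> / 8" using 1 2 by (rule add_mono)
        also have "\<dots> \<le> l * (\<delta> / 2)" using mult_pos_pos[OF l \<delta>(1)] by (simp add: mult.commute)
        finally show ?thesis .
      qed
      finally have "\<bar>sum b (clump R j0)\<bar> \<le> \<delta> / 2" using l by simp
      then have "\<bar>sum b (clump R j0) - 0\<bar> < \<delta>" using \<delta>(1) by linarith
      moreover have "clump R j0 \<subseteq> J" by (auto simp: clump_def)
      then have "sum b (clump R j0) \<in> T"
        using cJ finite_J bD card_mono[OF finite_J] by (intro T(3)) (auto intro: finite_subset order_trans)
      ultimately show ?thesis using \<delta>(2) T(2) by blast
    qed
    have "card {u. W u \<noteq> 0} \<le> card J * (2 * nat \<lfloor>R\<rfloor> + 1)"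
    proof (rule window_sum_support)
      show "0 \<le> R" using R by simp
      show "\<bar>w k - w j\<bar> \<le> R" if "j \<in> J" "k \<in> J" "\<bar>w k - w j\<bar> \<le> 2 * R" for j k
        using pair[OF that(2,1)] that(3) two by linarith
    qed (rule zero)
    also have "\<dots> \<le> N * (2 * nat \<lfloor>\<Gamma> ^ k\<rfloor> + 1)"
      using cJ R(2) by (intro mult_mono) (auto intro!: nat_mono floor_mono)
    finally show "card {u. (\<Sum>j\<in>{u..<u + int K}. \<alpha> j) \<noteq> 0} \<le> N * (2 * nat \<lfloor>\<Gamma> ^ k\<rfloor> + 1)"
      by (simp add: W_def)
  qed
qed

section \<open>Polynomials\<close>

text \<open>The guard matters: \<open>nat\<close> would map every \<open>j < - int n\<close> to the
  constant coefficient.\<close>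

definition centred :: "nat \<Rightarrow> real poly \<Rightarrow> int \<Rightarrow> real" where
  "centred n p j = (if - int n \<le> j then coeff p (nat (j + int n)) else 0)"

lemma centred_zero:
  assumes "degree p \<le> 2 * n" "int n < \<bar>j\<bar>"
  shows "centred n p j = 0"
  using assms by (auto simp: centred_def intro!: coeff_eq_0)

lemma centred_even:
  assumes "degree p \<le> 2 * n" "self_reciprocal (2 * n) p"
  shows "centred n p (- j) = centred n p j"
proof (cases "\<bar>j\<bar> \<le> int n")
  case True
  then have "nat (j + int n) \<le> 2 * n" "2 * n - nat (j + int n) = nat (int n - j)" by auto
  then have "coeff p (nat (j + int n)) = coeff p (nat (int n - j))"
    using assms(2) unfolding self_reciprocal_def by metis
  then show ?thesis using True by (simp add: centred_def abs_le_iff)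
next
  case False
  then show ?thesis using centred_zero[OF assms(1), of j] centred_zero[OF assms(1), of "- j"] by simp
qed

lemma centred_support: "degree p \<le> 2 * n \<Longrightarrow> {j. centred n p j \<noteq> 0} \<subseteq> {- int n..int n}"
  using centred_zero by force

lemma T_eq_cos_sum:
  assumes p: "degree p \<le> 2 * n" "self_reciprocal (2 * n) p"
  shows "T n p (complex_of_real t) = complex_of_real (cos_sum (centred n p) t)"
proof -
  let ?\<alpha> = "centred n p"
  have "T n p (complex_of_real t) = (\<Sum>k\<le>2 * n. of_real (coeff p k) * cis t ^ k) * cis (- (real n * t))"
  proof -
    have "poly (map_poly complex_of_real p) x = (\<Sum>k\<le>2 * n. of_real (coeff p k) * x ^ k)" for x
      unfolding poly_altdef using p(1)
      by (intro sum.mono_neutral_cong_left) (auto simp: coeff_map_poly coeff_eq_0 degree_map_poly)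
    then show ?thesis by (simp add: T_def cis_conv_exp algebra_simps)
  qed
  also have "\<dots> = (\<Sum>k\<le>2 * n. of_real (coeff p k) * cis ((real k - real n) * t))"
  proof -
    have "cis t ^ k * cis (- (real n * t)) = cis ((real k - real n) * t)" for k
      by (simp only: Complex.DeMoivre cis_mult) (simp add: left_diff_distrib)
    then show ?thesis by (simp add: sum_distrib_right mult.assoc)
  qed
  also have "\<dots> = (\<Sum>j\<in>{- int n..int n}. of_real (?\<alpha> j) * cis (of_int j * t))"
    by (rule sum.reindex_bij_witness[of _ "\<lambda>j. nat (j + int n)" "\<lambda>k. int k - int n"])
      (auto simp: centred_def)
  also have "\<dots> = of_real (\<Sum>j\<in>{- int n..int n}. ?\<alpha> j * cos (of_int j * t))
      + \<i> * of_real (\<Sum>j\<in>{- int n..int n}. ?\<alpha> j * sin (of_int j * t))"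
    by (simp add: cis.ctr Complex_eq sum.distrib sum_distrib_left algebra_simps)
  also have "(\<Sum>j\<in>{- int n..int n}. ?\<alpha> j * sin (of_int j * t)) = 0"
  proof -
    have "(\<Sum>j\<in>{- int n..int n}. ?\<alpha> j * sin (of_int j * t))
        = (\<Sum>j\<in>{- int n..int n}. ?\<alpha> (- j) * sin (of_int (- j) * t))"
      by (rule sum.reindex_bij_witness[of _ uminus uminus]) auto
    also have "\<dots> = - (\<Sum>j\<in>{- int n..int n}. ?\<alpha> j * sin (of_int j * t))"
      by (simp add: centred_even[OF p] sum_negf)
    finally show ?thesis by simp
  qed
  also have "(\<Sum>j\<in>{- int n..int n}. ?\<alpha> j * cos (of_int j * t)) = cos_sum ?\<alpha> t"
    by (rule cos_sum_superset[symmetric]) (use centred_support[OF p(1)] in auto)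
  finally show ?thesis by simp
qed

section \<open>Zeros on the unit circle\<close>

lemma cis_eq_shift:
  assumes "cis t = cis u" "\<bar>t - u\<bar> < 2 * pi"
  shows "t = u"
proof -
  have "sin t = sin u \<and> cos t = cos u" using assms(1) by (simp add: complex_eq_iff)
  then obtain m :: int where m: "t = u + 2 * pi * m" using sin_cos_eq_iff by blast
  then have "2 * pi * \<bar>real_of_int m\<bar> < 2 * pi * 1" using assms(2) by (simp add: abs_mult)
  then have "\<bar>real_of_int m\<bar> < 1" by (subst (asm) mult_less_cancel_left_pos) auto
  then have "m = 0" by linarith
  then show ?thesis using m by simp
qed

lemma cis_period_representative:
  fixes a t :: real
  obtains u where "u \<in> {a..<a + 2 * pi}" "cis u = cis t"
proof -
  define m where "m = \<lfloor>(t - a) / (2 * pi)\<rfloor>"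
  have "real_of_int m \<le> (t - a) / (2 * pi)" "(t - a) / (2 * pi) < real_of_int m + 1"
    unfolding m_def by linarith+
  then have "2 * pi * m \<le> t - a" "t - a < 2 * pi * m + 2 * pi"
    by (simp_all add: pos_le_divide_eq pos_divide_less_eq algebra_simps)
  moreover have "cis (t - 2 * pi * m) = cis t"
    using cis_multiple_2pi[of "of_int m"] by (simp flip: cis_divide)
  ultimately show thesis by (intro that[of "t - 2 * pi * m"]) auto
qed

text \<open>Through \<open>cis\<close> the zeros between 0 and \<open>pi\<close> inject into those
  of the period starting at \<open>a\<close>, and finiteness comes from polynomial roots. Each zero
  contributes at least 1, since \<open>zorder\<close> is positive at a zero of an entire function
  that is not identically 0.\<close>

lemma zeros_le_NZ:
  assumes NZ: "NZ a (T n p) \<le> enat M"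
  shows "finite {t::real. 0 < t \<and> t < pi \<and> T n p (of_real t) = 0}"
    "card {t::real. 0 < t \<and> t < pi \<and> T n p (of_real t) = 0} \<le> M"
proof -
  define f where "f = T n p"
  define q where "q = map_poly complex_of_real p"
  have f: "f (of_real t) = 0 \<longleftrightarrow> poly q (cis t) = 0" for t :: real
    by (simp add: f_def T_def q_def cis_conv_exp)
  have hol: "f holomorphic_on UNIV"
    unfolding f_def T_def by (intro holomorphic_intros holomorphic_on_compose) 
  define Z where "Z = {t. t \<in> {a..<a + 2 * pi} \<and> f (of_real t) = 0}"
  define Z0 where "Z0 = {t::real. 0 < t \<and> t < pi \<and> f (of_real t) = 0}"
  from NZ have "\<not> (\<forall>t::real. f (of_real t) = 0)"
    and sum: "(\<Sum>t\<in>Z. nat (zorder f (of_real t))) \<le> M"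
    unfolding NZ_def f_def[symmetric] Z_def by (auto split: if_splits)
  then obtain t0 :: real where t0: "f (of_real t0) \<noteq> 0" by blast
  have "q \<noteq> 0" using t0 unfolding f by (metis poly_0)
  then have roots: "finite {z. poly q z = 0}" by (rule poly_roots_finite)
  have injZ: "inj_on cis Z" "inj_on cis Z0"
    by (auto intro!: inj_onI cis_eq_shift simp: Z_def Z0_def abs_if)
  have sub: "cis ` Z \<subseteq> {z. poly q z = 0}" "cis ` Z0 \<subseteq> cis ` Z"
  proof -
    show "cis ` Z \<subseteq> {z. poly q z = 0}" using f by (auto simp: Z_def)
    show "cis ` Z0 \<subseteq> cis ` Z"
    proof (rule image_subsetI)
      fix t assume t: "t \<in> Z0"
      obtain u where "u \<in> {a..<a + 2 * pi}" "cis u = cis t" by (rule cis_period_representative)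
      then show "cis t \<in> cis ` Z"
        using t f by (intro image_eqI[of _ _ u]) (auto simp: Z_def Z0_def)
    qed
  qed
  have finZ: "finite Z" "finite Z0"
    using sub roots injZ by (meson finite_imageD finite_subset)+
  have "card Z0 = card (cis ` Z0)" using injZ by (simp add: card_image)
  also have "\<dots> \<le> card (cis ` Z)" using sub finZ by (intro card_mono) auto
  also have "\<dots> \<le> (\<Sum>t\<in>Z. 1)" using finZ by (simp add: card_image_le)
  also have "\<dots> \<le> (\<Sum>t\<in>Z. nat (zorder f (of_real t)))"
  proof (rule sum_mono)
    fix t assume t: "t \<in> Z"
    have "\<exists>w\<in>UNIV. f w \<noteq> 0" using t0 by blast
    then have "0 < zorder f (of_real t)"
      using zorder_exist_zero[OF hol open_UNIV connected_UNIV UNIV_I, of "of_real t"] t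
      by (simp add: Z_def)
    then show "1 \<le> nat (zorder f (of_real t))" by linarith
  qed
  finally have "card Z0 \<le> M" using sum by simp
  then show "finite {t::real. 0 < t \<and> t < pi \<and> T n p (of_real t) = 0}"
    "card {t::real. 0 < t \<and> t < pi \<and> T n p (of_real t) = 0} \<le> M"
    using finZ by (simp_all add: Z0_def f_def)
qed

text \<open>Shifting by \<open>n\<close> embeds the windows inside the coefficient range into all
  windows of the line. Finiteness is assumed because an infinite set has \<open>card\<close>
  0.\<close>

lemma NC_le_window_sums:
  assumes "finite {u. (\<Sum>j\<in>{u..<u + int k}. centred n p j) \<noteq> 0}"
  shows "NC k (2 * n) p \<le> card {u. (\<Sum>j\<in>{u..<u + int k}. centred n p j) \<noteq> 0}"
  unfolding NC_def
proof (rule card_inj_on_le[of "\<lambda>u. int u - int n"])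
  have "(\<Sum>j=u..<u + k. coeff p j) = (\<Sum>j\<in>{int u - int n..<int u - int n + int k}. centred n p j)" for u
    by (rule sum.reindex_bij_witness[of _ "\<lambda>j. nat (j + int n)" "\<lambda>j. int j - int n"])
      (auto simp: centred_def)
  then show "(\<lambda>u. int u - int n) ` {u. u + k \<le> 2 * n + 1 \<and> (\<Sum>j=u..<u + k. coeff p j) \<noteq> 0}
      \<subseteq> {u. (\<Sum>j\<in>{u..<u + int k}. centred n p j) \<noteq> 0}"
    by auto
  show "inj_on (\<lambda>u. int u - int n) {u. u + k \<le> 2 * n + 1 \<and> (\<Sum>j=u..<u + k. coeff p j) \<noteq> 0}"
    by (rule inj_onI) simp
qed (rule assms)

text \<open>The contrapositive in uniform form, with \<open>K\<close> and \<open>B\<close> fixed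
  before \<open>n\<close> and \<open>p\<close>. The value 0 joins \<open>S\<close> because
  \<open>centred\<close> vanishes outside the coefficient range.\<close>

lemma NZ_bounded_imp_NC_bounded:
  fixes S :: "real set"
  assumes S: "finite S"
  shows "\<exists>K\<ge>1. \<exists>B. \<forall>n p. degree p \<le> 2 * n \<longrightarrow> (\<forall>j\<le>2 * n. coeff p j \<in> S) \<longrightarrow> self_reciprocal (2 * n) p \<longrightarrow>
    NZ a (T n p) \<le> enat M \<longrightarrow> NC K (2 * n) p \<le> B"
proof -
  let ?S = "insert 0 S"
  let ?Z = "\<lambda>\<alpha>. {t. 0 < t \<and> t < pi \<and> cos_sum \<alpha> t = 0}"
  have fS: "finite ?S" using S by simp
  obtain K N where K: "1 \<le> K" and N: "\<And>\<alpha>. (\<forall>j. \<alpha> j \<in> ?S) \<Longrightarrow> (\<forall>j. \<alpha> (- j) = \<alpha> j) \<Longrightarrow> finite {j. \<alpha> j \<noteq> 0} \<Longrightarrow>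
      finite (?Z \<alpha>) \<Longrightarrow> card (?Z \<alpha>) \<le> M \<Longrightarrow> card {j. \<alpha> (j + int K) \<noteq> \<alpha> j} \<le> N"
    using few_zeros_almost_periodic[OF fS insertI1, of M] by blast
  obtain B where B: "\<And>\<alpha>. (\<forall>j. \<alpha> j \<in> ?S) \<Longrightarrow> (\<forall>j. \<alpha> (- j) = \<alpha> j) \<Longrightarrow> finite {j. \<alpha> j \<noteq> 0} \<Longrightarrow>
      finite (?Z \<alpha>) \<Longrightarrow> card (?Z \<alpha>) \<le> M \<Longrightarrow> card {j. \<alpha> (j + int K) \<noteq> \<alpha> j} \<le> N \<Longrightarrow>
      card {u. (\<Sum>j\<in>{u..<u + int K}. \<alpha> j) \<noteq> 0} \<le> B"
    using almost_periodic_few_window_sums[OF fS K, of M N] by blast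
  have "NC K (2 * n) p \<le> B"
    if p: "degree p \<le> 2 * n" "\<forall>j\<le>2 * n. coeff p j \<in> S" "self_reciprocal (2 * n) p" "NZ a (T n p) \<le> enat M"
    for n p
  proof -
    let ?\<alpha> = "centred n p"
    have val: "\<forall>j. ?\<alpha> j \<in> ?S"
    proof
      fix j
      show "?\<alpha> j \<in> ?S"
      proof (cases "\<bar>j\<bar> \<le> int n")
        case True
        then have "nat (j + int n) \<le> 2 * n" by auto
        then show ?thesis using p(2) by (simp add: centred_def)
      next
        case False
        then show ?thesis using centred_zero[OF p(1)] by simp
      qed
    qed
    have even: "\<forall>j. ?\<alpha> (- j) = ?\<alpha> j" using centred_even[OF p(1,3)] by blast
    have fin: "finite {j. ?\<alpha> j \<noteq> 0}"
      using centred_support[OF p(1)] finite_subset by blast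
    have Z: "finite (?Z ?\<alpha>)" "card (?Z ?\<alpha>) \<le> M"
      using zeros_le_NZ[OF p(4)] by (simp_all add: T_eq_cos_sum[OF p(1,3)])
    have "finite {u. (\<Sum>j\<in>{u..<u + int K}. ?\<alpha> j) \<noteq> 0}"
    proof (rule finite_subset)
      show "{u. (\<Sum>j\<in>{u..<u + int K}. ?\<alpha> j) \<noteq> 0} \<subseteq> {- int n - int K..int n}"
      proof (rule subsetI, rule ccontr)
        fix u assume u: "u \<in> {u. (\<Sum>j\<in>{u..<u + int K}. ?\<alpha> j) \<noteq> 0}" "u \<notin> {- int n - int K..int n}"
        have "(\<Sum>j\<in>{u..<u + int K}. ?\<alpha> j) = 0"
          by (rule sum.neutral) (use u(2) centred_zero[OF p(1)] in auto)
        then show False using u(1) by simp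
      qed
    qed simp
    then have "NC K (2 * n) p \<le> card {u. (\<Sum>j\<in>{u..<u + int K}. ?\<alpha> j) \<noteq> 0}"
      by (rule NC_le_window_sums)
    also have "\<dots> \<le> B"
      by (rule B[OF val even fin Z N[OF val even fin Z]])
    finally show ?thesis .
  qed
  then show ?thesis using K by blast
qed

theorem theorem2p1:
  fixes S :: "real set" and P :: "nat \<Rightarrow> real poly" and a :: real
  assumes "finite S"
    and "\<And>n. n \<ge> 1 \<Longrightarrow> degree (P (2 * n)) \<le> 2 * n"
    and "\<And>n j. n \<ge> 1 \<Longrightarrow> j \<le> 2 * n \<Longrightarrow> coeff (P (2 * n)) j \<in> S"
    and "\<And>n. n \<ge> 1 \<Longrightarrow> self_reciprocal (2 * n) (P (2 * n))"
    and "\<And>k. k \<ge> 1 \<Longrightarrow> filterlim (\<lambda>n. NC k (2 * n) (P (2 * n))) at_top sequentially"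
  shows "(\<lambda>n. NZ a (T n (P (2 * n)))) \<longlonglongrightarrow> \<infinity>"
proof (rule order_tendstoI)
  fix x :: enat assume "x < \<infinity>"
  then obtain M where M: "x = enat M" by (cases x) auto
  \<comment> \<open>\<open>M\<close> determines \<open>K\<close>, which is why growth of
    \<open>NC\<close> is assumed for every window length.\<close>
  obtain K B where K: "1 \<le> K" and B: "\<forall>n p. degree p \<le> 2 * n \<longrightarrow> (\<forall>j\<le>2 * n. coeff p j \<in> S) \<longrightarrow>
      self_reciprocal (2 * n) p \<longrightarrow> NZ a (T n p) \<le> enat M \<longrightarrow> NC K (2 * n) p \<le> B"
    using NZ_bounded_imp_NC_bounded[OF assms(1), of a M] by (elim exE conjE) (rule that)
  have "\<forall>\<^sub>F n in sequentially. B < NC K (2 * n) (P (2 * n))"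
    using assms(5)[OF K, unfolded filterlim_at_top, rule_format, of "Suc B"]
    by (simp add: Suc_le_eq)
  then show "\<forall>\<^sub>F n in sequentially. x < NZ a (T n (P (2 * n)))"
    using eventually_ge_at_top[of 1]
  proof eventually_elim
    case (elim n)
    show ?case
    proof (rule ccontr)
      assume "\<not> x < NZ a (T n (P (2 * n)))"
      then have "NC K (2 * n) (P (2 * n)) \<le> B"
        using assms(2-4)[OF elim(2)] by (intro B[rule_format]) (simp_all add: M not_less)
      then show False using elim(1) by simp
    qed
  qed
qed simp

end
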